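(* Let $(D,H,H^\vee)$ be a triple of Hopf algebras over $k$ with the data (coquasitriangular structure $\mathbf r_D$, Hopf maps $f\colon D\to H$, $g\colon D\to H^\vee$, skew-pairings $\mathbf r_H,\mathbf r_{H^\vee},\mathrm{ev}$) described in the context. Consider the quantum Manin pair $(\mathrm{CoMod}_D,\mathrm{CoMod}_H)$ with action functor $T$ and let $\mathcal F=TT^R(1)$. Let $A$ be an algebra in $\mathrm{CoMod}_H$. Then an algebra map $\mu\colon\mathcal F\to A$ in $\mathrm{CoMod}_H$ is a quantum moment map if and only if $$\mu(h)\,a=(h_{(1)}\triangleright a)\,\mu(h_{(0)})$$ for all $h\in\mathcal F$ and $a\in A$, where $\Delta(h)=h_{(0)}\otimes h_{(1)}\in\mathcal F\otimes H^\vee$ is the $H^\vee$-coaction on $\mathcal F$.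
   Context: $k$ is a commutative ring; $\mathrm{CoMod}_B$ denotes right $B$-comodules, with coaction $v\mapsto v_{(0)}\otimes v_{(1)}$. A skew-pairing of Hopf algebras $\gamma\colon P\otimes Q\to k$ is a bilinear form with $\gamma(pp',q)=\gamma(p,q_{(1)})\gamma(p',q_{(2)})$, $\gamma(p,qq')=\gamma(p_{(1)},q')\gamma(p_{(2)},q)$, $\gamma(p,1)=\epsilon(p)$, $\gamma(1,q)=\epsilon(q)$; $\gamma^{-1}$ is its convolution inverse and $\overline\gamma\colon Q\otimes P\to k$, $\overline\gamma(q,p)=\gamma^{-1}(p,q)$, is the inverse skew-pairing. A coquasitriangular structure on $D$ is a skew-pairing $\mathbf r_D\colon D\otimes D\to k$ with $\mathbf r_D(a_{(1)},b_{(1)})a_{(2)}b_{(2)}=\mathbf r_D(a_{(2)},b_{(2)})b_{(1)}a_{(1)}$. It makes $\mathrm{CoMod}_D$ braided monoidal via $v\otimes w\mapsto \mathbf r_D(v_{(1)},w_{(1)})\,w_{(0)}\otimes v_{(0)}$. Given a Hopf map $f\colon D\to H$, a $(D,\mathbf r_D)$-coquasitriangular structure on $H$ is a skew-pairing $\mathbf r_H\colon D\otimes H\to k$ with $\mathbf r_H(d_1,f(d_2))=\mathbf r_D(d_1,d_2)$ and $\mathbf r_H(d_{(1)},h_{(1)})f(d_{(2)})h_{(2)}=\mathbf r_H(d_{(2)},h_{(2)})h_{(1)}f(d_{(1)})$. Data: a coquasitriangular Hopf algebra $(D,\mathbf r_D)$; a $(D,\mathbf r_D)$-coquasitriangular Hopf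 algebra $(H,\mathbf r_H)$ with Hopf map $f\colon D\to H$; a $(D,\overline{\mathbf r}_D)$-coquasitriangular Hopf algebra $(H^\vee,\mathbf r_{H^\vee})$ with Hopf map $g\colon D\to H^\vee$; a skew-pairing $\mathrm{ev}\colon H^\vee\otimes H\to k$ with $\mathbf r_H(d,h)=\mathrm{ev}(g(d),h)$ and $\mathbf r_{H^\vee}^{-1}(d,h)=\mathrm{ev}(h,f(d))$. (Together these data give a quantum Manin triple $(\mathrm{CoMod}_D,\mathrm{CoMod}_H,\mathrm{CoMod}_{(H^\vee)^{op}})$, but only what follows is used in the statement.) The functor $T\colon\mathrm{CoMod}_D\to\mathrm{CoMod}_H$ is corestriction of coactions along $f$. For $X\in\mathrm{CoMod}_D$, $V\in\mathrm{CoMod}_H$ there is the natural isomorphism $\tau_{X,V}\colon T(X)\otimes V\to V\otimes T(X)$, $x\otimes v\mapsto\mathbf r_H(x_{(1)},v_{(1)})\,v_{(0)}\otimes x_{(0)}$. $T^R$ is the right adjoint of $T$; it is lax monoidal, so $T^R(1)$ is an algebra in $\mathrm{CoMod}_D$ and $\mathcal F=TT^R(1)$ is an algebra in $\mathrm{CoMod}_H$ (with the same underlying $k$-module as the $D$-comodule algebra $T^R(1)$). The $H^\vee$-coaction on $\mathcal F$ is the $D$-coaction on $T^R(1)$ corestricted along $g$. A right $H$-comodule $V$ becomes a left $H^\vee$-module via $h\triangleright v=v_{(0)}\,\mathrm{ev}(h,v_{(1)})$. An algebra map $\mu\colon\mathcal F\to A$ in $\mathrm{CoMod}_H$ is a quantum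 moment map if $m\circ(\mu\otimes\mathrm{id})=m\circ(\mathrm{id}\otimes\mu)\circ\tau_{T^R(1),A}$ as maps $\mathcal F\otimes A\to A$, where $m$ is the multiplication of $A$. *)

theory Defs
  imports "HOL-Algebra.Free_Abelian_Groups" "HOL-Algebra.Module"
begin

section \<open>Linear algebra over a commutative ring\<close>

definition base_module :: "('k, 'r) ring_scheme \<Rightarrow> ('k, 'k) module" where
  "base_module R = \<lparr>carrier = carrier R, monoid.mult = (\<otimes>\<^bsub>R\<^esub>), one = \<one>\<^bsub>R\<^esub>,
     ring.zero = \<zero>\<^bsub>R\<^esub>, add = (\<oplus>\<^bsub>R\<^esub>), smult = (\<otimes>\<^bsub>R\<^esub>)\<rparr>"

definition linear_map ::
  "('k, 'r) ring_scheme \<Rightarrow> ('k, 'm, 'x) module_scheme \<Rightarrow> ('k, 'n, 'y) module_scheme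
    \<Rightarrow> ('m \<Rightarrow> 'n) \<Rightarrow> bool" where
  "linear_map R M N h \<longleftrightarrow> h \<in> hom (add_monoid M) (add_monoid N) \<and>
     (\<forall>r\<in>carrier R. \<forall>x\<in>carrier M. h (r \<odot>\<^bsub>M\<^esub> x) = r \<odot>\<^bsub>N\<^esub> h x)"

definition bilinear_map ::
  "('k, 'r) ring_scheme \<Rightarrow> ('k, 'm, 'x) module_scheme \<Rightarrow> ('k, 'n, 'y) module_scheme
    \<Rightarrow> ('k, 'p, 'z) module_scheme \<Rightarrow> ('m \<Rightarrow> 'n \<Rightarrow> 'p) \<Rightarrow> bool" where
  "bilinear_map R M N P B \<longleftrightarrow>
     (\<forall>n\<in>carrier N. linear_map R M P (\<lambda>m. B m n)) \<and>
     (\<forall>m\<in>carrier M. linear_map R N P (B m))"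

text \<open>
  The tensor product over \<open>R\<close> is the free abelian group on \<open>M \<times> N\<close> modulo the subgroup
  generated by the relations of an \<open>R\<close>-balanced biadditive map.
\<close>

type_synonym ('m, 'n) tensor = "(('m \<times> 'n) \<Rightarrow>\<^sub>0 int) set"

definition tensor_rels ::
  "('k, 'r) ring_scheme \<Rightarrow> ('k, 'm, 'x) module_scheme \<Rightarrow> ('k, 'n, 'y) module_scheme
    \<Rightarrow> (('m \<times> 'n) \<Rightarrow>\<^sub>0 int) set" where
  "tensor_rels R M N =
     {frag_of (m \<oplus>\<^bsub>M\<^esub> m', n) - frag_of (m, n) - frag_of (m', n) | m m' n.
        m \<in> carrier M \<and> m' \<in> carrier M \<and> n \<in> carrier N} \<union>
     {frag_of (m, n \<oplus>\<^bsub>N\<^esub> n') - frag_of (m, n) - frag_of (m, n') | m n n'.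
        m \<in> carrier M \<and> n \<in> carrier N \<and> n' \<in> carrier N} \<union>
     {frag_of (r \<odot>\<^bsub>M\<^esub> m, n) - frag_of (m, r \<odot>\<^bsub>N\<^esub> n) | r m n.
        r \<in> carrier R \<and> m \<in> carrier M \<and> n \<in> carrier N}"

definition tensor_ker ::
  "('k, 'r) ring_scheme \<Rightarrow> ('k, 'm, 'x) module_scheme \<Rightarrow> ('k, 'n, 'y) module_scheme
    \<Rightarrow> ('m, 'n) tensor" where
  "tensor_ker R M N =
     generate (free_Abelian_group (carrier M \<times> carrier N)) (tensor_rels R M N)"

definition tensor_class ::
  "('k, 'r) ring_scheme \<Rightarrow> ('k, 'm, 'x) module_scheme \<Rightarrow> ('k, 'n, 'y) module_scheme
    \<Rightarrow> (('m \<times> 'n) \<Rightarrow>\<^sub>0 int) \<Rightarrow> ('m, 'n) tensor" where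
  "tensor_class R M N x =
     tensor_ker R M N #>\<^bsub>free_Abelian_group (carrier M \<times> carrier N)\<^esub> x"

definition pure_tensor ::
  "('k, 'r) ring_scheme \<Rightarrow> ('k, 'm, 'x) module_scheme \<Rightarrow> ('k, 'n, 'y) module_scheme
    \<Rightarrow> 'm \<Rightarrow> 'n \<Rightarrow> ('m, 'n) tensor" where
  "pure_tensor R M N m n = tensor_class R M N (frag_of (m, n))"

text \<open>
  The scalar \<open>r\<close> acts by \<open>r \<odot> (m \<otimes> n) = (r \<odot> m) \<otimes> n\<close>; the cosets in the union below all
  coincide.  The ring multiplication fields of the record are not used.
\<close>

definition tensor ::
  "('k, 'r) ring_scheme \<Rightarrow> ('k, 'm, 'x) module_scheme \<Rightarrow> ('k, 'n, 'y) module_scheme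
    \<Rightarrow> ('k, ('m, 'n) tensor) module" where
  "tensor R M N =
     (let Q = free_Abelian_group (carrier M \<times> carrier N) Mod tensor_ker R M N
      in \<lparr>carrier = carrier Q, monoid.mult = undefined, one = undefined,
          ring.zero = \<one>\<^bsub>Q\<^esub>, add = (\<otimes>\<^bsub>Q\<^esub>),
          smult = (\<lambda>r t. \<Union>x\<in>t. tensor_class R M N
                     (frag_extend (\<lambda>(m, n). frag_of (r \<odot>\<^bsub>M\<^esub> m, n)) x))\<rparr>)"

text \<open>
  The linear map \<open>M \<otimes> N \<rightarrow> P\<close> induced by a bilinear map \<open>B\<close>; it exists by the fact
  \<open>tensor_lift\<close> and is unique on the carrier by \<open>tensor_ext\<close>, both proved below.  It also expresses Sweedler sums: if \<open>t\<close> is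
  written \<open>x\<^sub>1 \<otimes> x\<^sub>2\<close> with summation understood, then \<open>tensor_lift R M N P B t\<close> is \<open>B x\<^sub>1 x\<^sub>2\<close>.
\<close>

definition tensor_lift ::
  "('k, 'r) ring_scheme \<Rightarrow> ('k, 'm, 'x) module_scheme \<Rightarrow> ('k, 'n, 'y) module_scheme
    \<Rightarrow> ('k, 'p, 'z) module_scheme \<Rightarrow> ('m \<Rightarrow> 'n \<Rightarrow> 'p) \<Rightarrow> ('m, 'n) tensor \<Rightarrow> 'p" where
  "tensor_lift R M N P B =
     (SOME h. linear_map R (tensor R M N) P h \<and>
        (\<forall>m\<in>carrier M. \<forall>n\<in>carrier N. h (pure_tensor R M N m n) = B m n))"

lemma tensor_rels_keys:
  assumes "module R M" "module R N" "x \<in> tensor_rels R M N"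
  shows "Poly_Mapping.keys x \<subseteq> carrier M \<times> carrier N"
proof -
  interpret M: module R M by fact
  interpret N: module R N by fact
  have fo: "Poly_Mapping.keys (frag_of p) \<subseteq> carrier M \<times> carrier N" if "p \<in> carrier M \<times> carrier N" for p
    using that by simp
  have d: "Poly_Mapping.keys (a - b) \<subseteq> carrier M \<times> carrier N"
    if "Poly_Mapping.keys a \<subseteq> carrier M \<times> carrier N" "Poly_Mapping.keys b \<subseteq> carrier M \<times> carrier N" for a b
    using that keys_diff[of a b] by blast
  show ?thesis
    using assms(3) unfolding tensor_rels_def
    by (elim UnE CollectE exE conjE; hypsubst; intro d fo; simp)
qed

lemma tensor_ker_subgroup:
  assumes "module R M" "module R N"
  shows "subgroup (tensor_ker R M N) (free_Abelian_group (carrier M \<times> carrier N))"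
  unfolding tensor_ker_def
  by (rule group.generate_is_subgroup) (use tensor_rels_keys[OF assms] in \<open>auto simp: subset_iff\<close>)

lemma tensor_ker_normal:
  assumes "module R M" "module R N"
  shows "tensor_ker R M N \<lhd> free_Abelian_group (carrier M \<times> carrier N)"
  using comm_group.normal_iff_subgroup[OF abelian_free_Abelian_group] tensor_ker_subgroup[OF assms] by blast

lemma tensor_simps:
  "carrier (tensor R M N) = carrier (free_Abelian_group (carrier M \<times> carrier N) Mod tensor_ker R M N)"
  "(\<oplus>\<^bsub>tensor R M N\<^esub>) = (\<otimes>\<^bsub>free_Abelian_group (carrier M \<times> carrier N) Mod tensor_ker R M N\<^esub>)"
  "\<zero>\<^bsub>tensor R M N\<^esub> = \<one>\<^bsub>free_Abelian_group (carrier M \<times> carrier N) Mod tensor_ker R M N\<^esub>"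
  by (simp_all add: tensor_def Let_def)

lemma hom_add_monoid_tensor:
  "hom (add_monoid (tensor R M N)) Q = hom (free_Abelian_group (carrier M \<times> carrier N) Mod tensor_ker R M N) Q"
  "hom Q' (add_monoid (tensor R M N)) = hom Q' (free_Abelian_group (carrier M \<times> carrier N) Mod tensor_ker R M N)"
  unfolding hom_def by (simp_all only: tensor_simps(1,2) partial_object.simps monoid.simps)

lemma tensor_abelian_group:
  assumes "module R M" "module R N"
  shows "abelian_group (tensor R M N)"
proof -
  interpret Q: comm_group "free_Abelian_group (carrier M \<times> carrier N) Mod tensor_ker R M N"
    by (rule comm_group.abelian_FactGroup[OF abelian_free_Abelian_group tensor_ker_subgroup[OF assms]])
  show ?thesis
    by (rule abelian_groupI; unfold tensor_simps)
      (rule Q.m_assoc Q.m_comm Q.l_inv_ex Q.m_closed Q.one_closed Q.l_one; assumption)+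
qed

lemma tensor_comm_group:
  assumes "module R M" "module R N"
  shows "comm_group (add_monoid (tensor R M N))"
  using abelian_group.a_comm_group[OF tensor_abelian_group[OF assms]] .

lemma tensor_carrier:
  "carrier (tensor R M N) = tensor_class R M N ` {x. Poly_Mapping.keys x \<subseteq> carrier M \<times> carrier N}"
  by (auto simp: tensor_simps carrier_FactGroup tensor_class_def)

lemma tensor_class_hom:
  assumes "module R M" "module R N"
  shows "tensor_class R M N \<in> hom (free_Abelian_group (carrier M \<times> carrier N)) (add_monoid (tensor R M N))"
  using normal.r_coset_hom_Mod[OF tensor_ker_normal[OF assms]]
  by (simp add: hom_add_monoid_tensor tensor_class_def[abs_def])

lemma tensor_class_add:
  assumes "module R M" "module R N" "Poly_Mapping.keys x \<subseteq> carrier M \<times> carrier N" "Poly_Mapping.keys y \<subseteq> carrier M \<times> carrier N"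
  shows "tensor_class R M N (x + y) = tensor_class R M N x \<oplus>\<^bsub>tensor R M N\<^esub> tensor_class R M N y"
  using hom_mult[OF tensor_class_hom[OF assms(1,2)], of x y] assms(3,4) by simp

lemma tensor_class_hom':
  assumes "module R M" "module R N"
  shows "group_hom (free_Abelian_group (carrier M \<times> carrier N)) (add_monoid (tensor R M N)) (tensor_class R M N)"
  using tensor_class_hom[OF assms] comm_group.axioms(2)[OF tensor_comm_group[OF assms]]
  by (simp add: group_hom_def group_hom_axioms_def)

lemma tensor_class_minus:
  assumes "module R M" "module R N" "Poly_Mapping.keys x \<subseteq> carrier M \<times> carrier N"
  shows "tensor_class R M N (- x) = \<ominus>\<^bsub>tensor R M N\<^esub> tensor_class R M N x"
  using group_hom.hom_inv[OF tensor_class_hom'[OF assms(1,2)], of x] assms(3) by (simp add: a_inv_def)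

lemma tensor_class_diff:
  assumes "module R M" "module R N" "Poly_Mapping.keys x \<subseteq> carrier M \<times> carrier N" "Poly_Mapping.keys y \<subseteq> carrier M \<times> carrier N"
  shows "tensor_class R M N (x - y) = tensor_class R M N x \<ominus>\<^bsub>tensor R M N\<^esub> tensor_class R M N y"
  using tensor_class_add[OF assms(1-3), of "-y"] tensor_class_minus[OF assms(1,2,4)] assms(4)
  by (simp add: a_minus_def)

lemma tensor_class_0:
  assumes "module R M" "module R N"
  shows "tensor_class R M N 0 = \<zero>\<^bsub>tensor R M N\<^esub>"
  using group_hom.hom_one[OF tensor_class_hom'[OF assms]] by simp

lemma tensor_class_closed:
  assumes "Poly_Mapping.keys x \<subseteq> carrier M \<times> carrier N"
  shows "tensor_class R M N x \<in> carrier (tensor R M N)"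
  using assms by (auto simp: tensor_carrier)

lemma pure_tensor_closed [simp]:
  "m \<in> carrier M \<Longrightarrow> n \<in> carrier N \<Longrightarrow> pure_tensor R M N m n \<in> carrier (tensor R M N)"
  by (auto simp: pure_tensor_def intro: tensor_class_closed)

lemma tensor_induct:
  assumes "module R M" "module R N" "t \<in> carrier (tensor R M N)"
    and "P \<zero>\<^bsub>tensor R M N\<^esub>"
    and diff: "\<And>s t. \<lbrakk>s \<in> carrier (tensor R M N); t \<in> carrier (tensor R M N); P s; P t\<rbrakk> \<Longrightarrow> P (s \<ominus>\<^bsub>tensor R M N\<^esub> t)"
    and pure: "\<And>m n. m \<in> carrier M \<Longrightarrow> n \<in> carrier N \<Longrightarrow> P (pure_tensor R M N m n)"
  shows "P t"
proof -
  obtain x where x: "Poly_Mapping.keys x \<subseteq> carrier M \<times> carrier N" "t = tensor_class R M N x"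
    using assms(3) by (auto simp: tensor_carrier)
  have "P (tensor_class R M N x)"
  proof (rule free_Abelian_group_induct[OF x(1)])
    show "P (tensor_class R M N 0)" using assms(4) tensor_class_0[OF assms(1,2)] by simp
  next
    fix x y assume "Poly_Mapping.keys x \<subseteq> carrier M \<times> carrier N" "Poly_Mapping.keys y \<subseteq> carrier M \<times> carrier N"
      "P (tensor_class R M N x)" "P (tensor_class R M N y)"
    then show "P (tensor_class R M N (x - y))"
      using diff[OF tensor_class_closed tensor_class_closed] tensor_class_diff[OF assms(1,2)] by simp
  next
    fix a assume "a \<in> carrier M \<times> carrier N"
    then show "P (tensor_class R M N (frag_of a))" using pure by (auto simp: pure_tensor_def)
  qed
  then show ?thesis using x by simp
qed

lemma tensor_class_rel:
  assumes "module R M" "module R N" "x - y \<in> tensor_ker R M N"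
    "Poly_Mapping.keys x \<subseteq> carrier M \<times> carrier N" "Poly_Mapping.keys y \<subseteq> carrier M \<times> carrier N"
  shows "tensor_class R M N x = tensor_class R M N y"
proof -
  let ?G = "free_Abelian_group (carrier M \<times> carrier N)"
  have "x \<in> tensor_class R M N y"
    unfolding tensor_class_def r_coset_def using assms(3) by force
  then show ?thesis unfolding tensor_class_def
    using group.repr_independence[OF group_free_Abelian_group _ _ tensor_ker_subgroup[OF assms(1,2)]] assms(4,5)
    by (metis carrier_free_Abelian_group_iff)
qed

lemma tensor_rel_zero:
  assumes "module R M" "module R N" "x \<in> tensor_rels R M N"
  shows "tensor_class R M N x = \<zero>\<^bsub>tensor R M N\<^esub>"
  using tensor_class_rel[OF assms(1,2), of x 0] tensor_class_0[OF assms(1,2)] tensor_rels_keys[OF assms] assms(3)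
  by (simp add: tensor_ker_def generate.incl)

lemma pure_add_left:
  assumes "module R M" "module R N" "m \<in> carrier M" "m' \<in> carrier M" "n \<in> carrier N"
  shows "pure_tensor R M N (m \<oplus>\<^bsub>M\<^esub> m') n = pure_tensor R M N m n \<oplus>\<^bsub>tensor R M N\<^esub> pure_tensor R M N m' n"
proof -
  interpret M: module R M by fact
  have "frag_of (m \<oplus>\<^bsub>M\<^esub> m', n) - (frag_of (m, n) + frag_of (m', n)) \<in> tensor_rels R M N"
    unfolding tensor_rels_def using assms by (auto simp: diff_diff_eq)
  then have "tensor_class R M N (frag_of (m \<oplus>\<^bsub>M\<^esub> m', n)) = tensor_class R M N (frag_of (m, n) + frag_of (m', n))"
    by (intro tensor_class_rel[OF assms(1,2)])
      (use assms keys_add[of "frag_of (m,n)" "frag_of (m',n)"] in \<open>auto simp: tensor_ker_def generate.incl\<close>)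
  then show ?thesis
    using assms tensor_class_add[OF assms(1,2)] by (simp add: pure_tensor_def)
qed

lemma pure_add_right:
  assumes "module R M" "module R N" "m \<in> carrier M" "n' \<in> carrier N" "n \<in> carrier N"
  shows "pure_tensor R M N m (n \<oplus>\<^bsub>N\<^esub> n') = pure_tensor R M N m n \<oplus>\<^bsub>tensor R M N\<^esub> pure_tensor R M N m n'"
proof -
  interpret M: module R N by fact
  have "frag_of (m, n \<oplus>\<^bsub>N\<^esub> n') - (frag_of (m, n) + frag_of (m, n')) \<in> tensor_rels R M N"
    unfolding tensor_rels_def using assms by (auto simp: diff_diff_eq)
  then have "tensor_class R M N (frag_of (m, n \<oplus>\<^bsub>N\<^esub> n')) = tensor_class R M N (frag_of (m, n) + frag_of (m, n'))"
    by (intro tensor_class_rel[OF assms(1,2)])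
      (use assms keys_add[of "frag_of (m,n)" "frag_of (m,n')"] in \<open>auto simp: tensor_ker_def generate.incl\<close>)
  then show ?thesis
    using assms tensor_class_add[OF assms(1,2)] by (simp add: pure_tensor_def)
qed

lemma pure_smult:
  assumes "module R M" "module R N" "m \<in> carrier M" "n \<in> carrier N" "r \<in> carrier R"
  shows "pure_tensor R M N (r \<odot>\<^bsub>M\<^esub> m) n = pure_tensor R M N m (r \<odot>\<^bsub>N\<^esub> n)"
proof -
  interpret M: module R M by fact
  interpret N: module R N by fact
  have "frag_of (r \<odot>\<^bsub>M\<^esub> m, n) - frag_of (m, r \<odot>\<^bsub>N\<^esub> n) \<in> tensor_rels R M N"
    unfolding tensor_rels_def using assms by (auto simp: diff_diff_eq)
  then have "tensor_class R M N (frag_of (r \<odot>\<^bsub>M\<^esub> m, n)) = tensor_class R M N (frag_of (m, r \<odot>\<^bsub>N\<^esub> n))"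
    by (intro tensor_class_rel[OF assms(1,2)])
      (use assms in \<open>auto simp: tensor_ker_def generate.incl\<close>)
  then show ?thesis
    using assms tensor_class_add[OF assms(1,2)] by (simp add: pure_tensor_def)
qed

lemma tensor_universal:
  assumes M: "module R M" and N: "module R N" and Q: "comm_group Q"
    and cl: "\<And>m n. m \<in> carrier M \<Longrightarrow> n \<in> carrier N \<Longrightarrow> B m n \<in> carrier Q"
    and l: "\<And>m m' n. m \<in> carrier M \<Longrightarrow> m' \<in> carrier M \<Longrightarrow> n \<in> carrier N \<Longrightarrow> B (m \<oplus>\<^bsub>M\<^esub> m') n = B m n \<otimes>\<^bsub>Q\<^esub> B m' n"
    and r: "\<And>m n n'. m \<in> carrier M \<Longrightarrow> n \<in> carrier N \<Longrightarrow> n' \<in> carrier N \<Longrightarrow> B m (n \<oplus>\<^bsub>N\<^esub> n') = B m n \<otimes>\<^bsub>Q\<^esub> B m n'"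
    and s: "\<And>c m n. c \<in> carrier R \<Longrightarrow> m \<in> carrier M \<Longrightarrow> n \<in> carrier N \<Longrightarrow> B (c \<odot>\<^bsub>M\<^esub> m) n = B m (c \<odot>\<^bsub>N\<^esub> n)"
  obtains h where "h \<in> hom (add_monoid (tensor R M N)) Q"
    "\<And>m n. m \<in> carrier M \<Longrightarrow> n \<in> carrier N \<Longrightarrow> h (pure_tensor R M N m n) = B m n"
    "\<And>h' x. h' \<in> hom (free_Abelian_group (carrier M \<times> carrier N)) Q \<Longrightarrow>
       (\<And>m n. m \<in> carrier M \<Longrightarrow> n \<in> carrier N \<Longrightarrow> h' (frag_of (m,n)) = B m n) \<Longrightarrow>
       Poly_Mapping.keys x \<subseteq> carrier M \<times> carrier N \<Longrightarrow> h (tensor_class R M N x) = h' x"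
proof -
  interpret M: module R M by fact
  interpret N: module R N by fact
  interpret Q: comm_group Q by fact
  let ?S = "carrier M \<times> carrier N"
  let ?G = "free_Abelian_group ?S"
  obtain k where k: "k \<in> hom ?G Q" "\<And>x. x \<in> ?S \<Longrightarrow> k (frag_of x) = case_prod B x"
    using Q.free_Abelian_group_universal[of "case_prod B" ?S] cl by (metis (no_types, lifting) SigmaE case_prod_conv image_subsetI)
  interpret k: group_hom ?G Q k
    by (simp add: group_hom_def group_hom_axioms_def k(1))
  have kd: "k (x - y) = k x \<otimes>\<^bsub>Q\<^esub> inv\<^bsub>Q\<^esub> k y" if "Poly_Mapping.keys x \<subseteq> ?S" "Poly_Mapping.keys y \<subseteq> ?S" for x y
    using k.hom_mult[of x "-y"] k.hom_inv[of y] that by simp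
  have ks: "Poly_Mapping.keys (x - y) \<subseteq> ?S" if "Poly_Mapping.keys x \<subseteq> ?S" "Poly_Mapping.keys y \<subseteq> ?S" for x y :: "_ \<Rightarrow>\<^sub>0 int"
    using that keys_diff[of x y] by blast
  have canc: "a \<otimes>\<^bsub>Q\<^esub> b \<otimes>\<^bsub>Q\<^esub> inv\<^bsub>Q\<^esub> a \<otimes>\<^bsub>Q\<^esub> inv\<^bsub>Q\<^esub> b = \<one>\<^bsub>Q\<^esub>" if "a \<in> carrier Q" "b \<in> carrier Q" for a b
    using that by (metis Q.inv_closed Q.inv_solve_right Q.m_closed Q.m_comm Q.r_inv Q.r_one Q.m_assoc)
  have "tensor_rels R M N \<subseteq> kernel ?G Q k"
  proof
    fix x assume x: "x \<in> tensor_rels R M N"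
    have "k x = \<one>\<^bsub>Q\<^esub>"
      using x unfolding tensor_rels_def
      apply (elim UnE CollectE exE conjE)
      by (hypsubst, simp add: kd ks k(2) l r s cl canc)+
    then show "x \<in> kernel ?G Q k"
      using tensor_rels_keys[OF M N x] by (simp add: kernel_def)
  qed
  then have "tensor_ker R M N \<subseteq> kernel ?G Q k"
    unfolding tensor_ker_def
    by (intro group.generate_subgroup_incl[OF group_free_Abelian_group]) (auto intro: k.subgroup_kernel)
  then obtain h where h: "h \<in> hom (?G Mod tensor_ker R M N) Q" 
     "\<And>x. x \<in> carrier ?G \<Longrightarrow> h (tensor_ker R M N #>\<^bsub>?G\<^esub> x) = k x"
    using k.FactGroup_universal_kernel[OF tensor_ker_normal[OF M N]] by metis
  show thesis
  proof
    show "h \<in> hom (add_monoid (tensor R M N)) Q" using h(1) by (simp add: hom_add_monoid_tensor)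
    show "h (pure_tensor R M N m n) = B m n" if "m \<in> carrier M" "n \<in> carrier N" for m n
      using that h(2)[of "frag_of (m,n)"] k(2)[of "(m,n)"] by (simp add: pure_tensor_def tensor_class_def)
    fix h' and x :: "_ \<Rightarrow>\<^sub>0 int" assume h': "h' \<in> hom ?G Q" "\<And>m n. m \<in> carrier M \<Longrightarrow> n \<in> carrier N \<Longrightarrow> h' (frag_of (m,n)) = B m n" "Poly_Mapping.keys x \<subseteq> ?S"
    interpret h': group_hom ?G Q h'
      by (simp add: group_hom_def group_hom_axioms_def h'(1))
    have hd: "h' (x - y) = h' x \<otimes>\<^bsub>Q\<^esub> inv\<^bsub>Q\<^esub> h' y" if "Poly_Mapping.keys x \<subseteq> ?S" "Poly_Mapping.keys y \<subseteq> ?S" for x y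
      using h'.hom_mult[of x "-y"] h'.hom_inv[of y] that by simp
    have "k x = h' x"
    proof (rule free_Abelian_group_induct[OF h'(3)])
      show "k 0 = h' 0" using k.hom_one h'.hom_one by simp
      show "\<And>x y. \<lbrakk>Poly_Mapping.keys x \<subseteq> ?S; Poly_Mapping.keys y \<subseteq> ?S; k x = h' x; k y = h' y\<rbrakk> \<Longrightarrow> k (x - y) = h' (x - y)"
        by (simp add: kd hd)
      show "\<And>a. a \<in> ?S \<Longrightarrow> k (frag_of a) = h' (frag_of a)" using k(2) h'(2) by auto
    qed
    then show "h (tensor_class R M N x) = h' x"
      using h(2)[of x] h'(3) by (simp add: tensor_class_def)
  qed
qed

lemma tensor_smult_hom:
  assumes M: "module R M" and N: "module R N" and c: "c \<in> carrier R"
  shows "(\<lambda>t. c \<odot>\<^bsub>tensor R M N\<^esub> t) \<in> hom (add_monoid (tensor R M N)) (add_monoid (tensor R M N))"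
    and "\<And>m n. m \<in> carrier M \<Longrightarrow> n \<in> carrier N \<Longrightarrow>
      c \<odot>\<^bsub>tensor R M N\<^esub> pure_tensor R M N m n = pure_tensor R M N (c \<odot>\<^bsub>M\<^esub> m) n"
proof -
  interpret M: module R M by fact
  interpret N: module R N by fact
  let ?T = "tensor R M N"
  let ?S = "carrier M \<times> carrier N"
  let ?G = "free_Abelian_group ?S"
  let ?e = "frag_extend (\<lambda>(m, n). frag_of (c \<odot>\<^bsub>M\<^esub> m, n))"
  have e: "Poly_Mapping.keys (?e x) \<subseteq> ?S" if "Poly_Mapping.keys x \<subseteq> ?S" for x
    using that keys_frag_extend[of "\<lambda>(m, n). frag_of (c \<odot>\<^bsub>M\<^esub> m, n)" x] c by fastforce
  let ?B = "\<lambda>m n. pure_tensor R M N (c \<odot>\<^bsub>M\<^esub> m) n"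
  have b1: "?B m n \<in> carrier (add_monoid ?T)" if "m \<in> carrier M" "n \<in> carrier N" for m n
    using that c by simp
  have b2: "?B (m \<oplus>\<^bsub>M\<^esub> m') n = ?B m n \<otimes>\<^bsub>add_monoid ?T\<^esub> ?B m' n" if "m \<in> carrier M" "m' \<in> carrier M" "n \<in> carrier N" for m m' n
    using that c by (simp add: M.smult_r_distr pure_add_left[OF M N])
  have b3: "?B m (n \<oplus>\<^bsub>N\<^esub> n') = ?B m n \<otimes>\<^bsub>add_monoid ?T\<^esub> ?B m n'" if "m \<in> carrier M" "n \<in> carrier N" "n' \<in> carrier N" for m n n'
    using that c by (simp add: pure_add_right[OF M N])
  have b4: "?B (c' \<odot>\<^bsub>M\<^esub> m) n = ?B m (c' \<odot>\<^bsub>N\<^esub> n)" if "c' \<in> carrier R" "m \<in> carrier M" "n \<in> carrier N" for c' m n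
    using that c by (simp add: pure_smult[OF M N, symmetric] M.smult_assoc1[symmetric] M.R.m_comm)
  obtain h where h: "h \<in> hom (add_monoid ?T) (add_monoid ?T)"
    "\<And>m n. m \<in> carrier M \<Longrightarrow> n \<in> carrier N \<Longrightarrow> h (pure_tensor R M N m n) = pure_tensor R M N (c \<odot>\<^bsub>M\<^esub> m) n"
    "\<And>h' x. h' \<in> hom ?G (add_monoid ?T) \<Longrightarrow>
       (\<And>m n. m \<in> carrier M \<Longrightarrow> n \<in> carrier N \<Longrightarrow> h' (frag_of (m,n)) = pure_tensor R M N (c \<odot>\<^bsub>M\<^esub> m) n) \<Longrightarrow>
       Poly_Mapping.keys x \<subseteq> carrier M \<times> carrier N \<Longrightarrow> h (tensor_class R M N x) = h' x"
    apply (rule tensor_universal[OF M N tensor_comm_group[OF M N], of ?B])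
        apply (rule b1; assumption)
       apply (rule b2; assumption)
      apply (rule b3; assumption)
     apply (rule b4; assumption)
    subgoal premises p for h
      by (rule that[of h]) (fact p(2), (rule p(3); assumption), (rule p(4); assumption))
    done
  have "(\<lambda>x. tensor_class R M N (?e x)) \<in> hom ?G (add_monoid ?T)"
    by (rule homI) (use e in \<open>auto simp: frag_extend_add tensor_class_add[OF M N] intro!: tensor_class_closed\<close>)
  then have hx: "h (tensor_class R M N x) = tensor_class R M N (?e x)" if "Poly_Mapping.keys x \<subseteq> ?S" for x
    by (rule h(3)) (use that in \<open>auto simp: pure_tensor_def\<close>)
  have eq: "c \<odot>\<^bsub>?T\<^esub> t = h t" if t: "t \<in> carrier ?T" for t
  proof -
    obtain x where x: "Poly_Mapping.keys x \<subseteq> ?S" "t = tensor_class R M N x"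
      using t unfolding tensor_carrier by blast
    have tx: "t = tensor_ker R M N #>\<^bsub>?G\<^esub> x" using x(2) by (simp add: tensor_class_def)
    have sub: "Poly_Mapping.keys y \<subseteq> ?S \<and> tensor_class R M N y = t" if y: "y \<in> t" for y
    proof -
      have y': "y \<in> tensor_ker R M N #>\<^bsub>?G\<^esub> x" using y tx by simp
      have xG: "x \<in> carrier ?G" using x(1) by simp
      have "y \<in> carrier ?G"
        using subsetD[OF monoid.r_coset_subset_G[OF group.is_monoid[OF group_free_Abelian_group] subgroup.subset[OF tensor_ker_subgroup[OF M N]] xG] y'] .
      moreover have "tensor_ker R M N #>\<^bsub>?G\<^esub> x = tensor_ker R M N #>\<^bsub>?G\<^esub> y"
        by (rule group.repr_independence[OF group_free_Abelian_group y' xG tensor_ker_subgroup[OF M N]])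
      ultimately show ?thesis using tx by (simp add: tensor_class_def)
    qed
    have "x \<in> t" unfolding x tensor_class_def
      by (rule group.rcos_self[OF group_free_Abelian_group _ tensor_ker_subgroup[OF M N]]) (use x in simp)
    moreover have "tensor_class R M N (?e y) = h t" if "y \<in> t" for y
      using sub[OF that] hx by metis
    ultimately have "(\<Union>y\<in>t. tensor_class R M N (?e y)) = h t" by blast
    then show ?thesis by (simp add: tensor_def Let_def)
  qed
  show "(\<lambda>t. c \<odot>\<^bsub>?T\<^esub> t) \<in> hom (add_monoid ?T) (add_monoid ?T)"
    using h(1) tensor_abelian_group[OF M N] eq
    by (auto simp: hom_def Pi_def abelian_monoid.a_closed abelian_group.axioms)
  show "\<And>m n. m \<in> carrier M \<Longrightarrow> n \<in> carrier N \<Longrightarrow>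
      c \<odot>\<^bsub>?T\<^esub> pure_tensor R M N m n = pure_tensor R M N (c \<odot>\<^bsub>M\<^esub> m) n"
    using eq h(2) by simp
qed

lemma add_hom_minus:
  assumes "abelian_group M" "abelian_group N" "h \<in> hom (add_monoid M) (add_monoid N)"
    "x \<in> carrier M" "y \<in> carrier M"
  shows "h (x \<ominus>\<^bsub>M\<^esub> y) = h x \<ominus>\<^bsub>N\<^esub> h y"
proof -
  interpret M: abelian_group M by fact
  interpret N: abelian_group N by fact
  interpret group_hom "add_monoid M" "add_monoid N" h
    using assms by (simp add: group_hom_def group_hom_axioms_def M.a_group N.a_group)
  show ?thesis using hom_mult[of x "\<ominus>\<^bsub>M\<^esub> y"] hom_inv[of y] assms(4,5) by (simp add: a_minus_def a_inv_def[symmetric])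
qed

lemma add_hom_zero:
  assumes "abelian_group M" "abelian_group N" "h \<in> hom (add_monoid M) (add_monoid N)"
  shows "h \<zero>\<^bsub>M\<^esub> = \<zero>\<^bsub>N\<^esub>"
proof -
  interpret M: abelian_group M by fact
  interpret N: abelian_group N by fact
  interpret group_hom "add_monoid M" "add_monoid N" h
    using assms by (simp add: group_hom_def group_hom_axioms_def M.a_group N.a_group)
  show ?thesis using hom_one by simp
qed

lemma add_hom_ext:
  assumes M: "module R M" and N: "module R N" and P: "abelian_group P"
    and "h \<in> hom (add_monoid (tensor R M N)) (add_monoid P)" "h' \<in> hom (add_monoid (tensor R M N)) (add_monoid P)"
    and "\<And>m n. m \<in> carrier M \<Longrightarrow> n \<in> carrier N \<Longrightarrow> h (pure_tensor R M N m n) = h' (pure_tensor R M N m n)"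
    and "t \<in> carrier (tensor R M N)"
  shows "h t = h' t"
  by (rule tensor_induct[OF M N assms(7)])
    (simp_all add: add_hom_zero[OF tensor_abelian_group[OF M N] P] add_hom_minus[OF tensor_abelian_group[OF M N] P] assms)

lemma tensor_module:
  assumes M: "module R M" and N: "module R N"
  shows "module R (tensor R M N)"
proof -
  interpret M: module R M by fact
  interpret N: module R N by fact
  let ?T = "tensor R M N"
  note ag = tensor_abelian_group[OF M N]
  interpret T: abelian_group ?T by fact
  note sm = tensor_smult_hom[OF M N]
  have cl: "c \<odot>\<^bsub>?T\<^esub> t \<in> carrier ?T" if "c \<in> carrier R" "t \<in> carrier ?T" for c t
    using sm(1)[OF that(1)] that by (auto simp: hom_def)
  show ?thesis
  proof (rule moduleI)
    show "cring R" by (rule M.R.is_cring)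
    show "abelian_group ?T" by fact
    show "a \<odot>\<^bsub>?T\<^esub> x \<in> carrier ?T" if "a \<in> carrier R" "x \<in> carrier ?T" for a x using cl that by simp
    show "a \<odot>\<^bsub>?T\<^esub> (x \<oplus>\<^bsub>?T\<^esub> y) = (a \<odot>\<^bsub>?T\<^esub> x) \<oplus>\<^bsub>?T\<^esub> (a \<odot>\<^bsub>?T\<^esub> y)"
      if "a \<in> carrier R" "x \<in> carrier ?T" "y \<in> carrier ?T" for a x y
      using sm(1)[OF that(1)] that by (auto simp: hom_def)
    show "(a \<oplus>\<^bsub>R\<^esub> b) \<odot>\<^bsub>?T\<^esub> x = (a \<odot>\<^bsub>?T\<^esub> x) \<oplus>\<^bsub>?T\<^esub> (b \<odot>\<^bsub>?T\<^esub> x)"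
      if a: "a \<in> carrier R" "b \<in> carrier R" and x: "x \<in> carrier ?T" for a b x
    proof (rule add_hom_ext[OF M N ag _ _ _ x])
      show "(\<odot>\<^bsub>?T\<^esub>) (a \<oplus>\<^bsub>R\<^esub> b) \<in> hom (add_monoid ?T) (add_monoid ?T)" using sm(1) a by simp
      show "(\<lambda>x. (a \<odot>\<^bsub>?T\<^esub> x) \<oplus>\<^bsub>?T\<^esub> (b \<odot>\<^bsub>?T\<^esub> x)) \<in> hom (add_monoid ?T) (add_monoid ?T)"
        using sm(1)[OF a(1)] sm(1)[OF a(2)] cl a by (auto simp: hom_def T.a_ac)
    qed (use a in \<open>simp add: sm(2) M.smult_l_distr pure_add_left[OF M N]\<close>)
    show "(a \<otimes>\<^bsub>R\<^esub> b) \<odot>\<^bsub>?T\<^esub> x = a \<odot>\<^bsub>?T\<^esub> (b \<odot>\<^bsub>?T\<^esub> x)"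
      if a: "a \<in> carrier R" "b \<in> carrier R" and x: "x \<in> carrier ?T" for a b x
    proof (rule add_hom_ext[OF M N ag _ _ _ x])
      show "(\<odot>\<^bsub>?T\<^esub>) (a \<otimes>\<^bsub>R\<^esub> b) \<in> hom (add_monoid ?T) (add_monoid ?T)" using sm(1) a by simp
      show "(\<lambda>x. a \<odot>\<^bsub>?T\<^esub> (b \<odot>\<^bsub>?T\<^esub> x)) \<in> hom (add_monoid ?T) (add_monoid ?T)"
        using sm(1)[OF a(1)] sm(1)[OF a(2)] cl a by (auto simp: hom_def)
    qed (use a in \<open>simp add: sm(2) M.smult_assoc1\<close>)
    show "\<one>\<^bsub>R\<^esub> \<odot>\<^bsub>?T\<^esub> x = x" if x: "x \<in> carrier ?T" for x
    proof (rule add_hom_ext[OF M N ag _ _ _ x])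
      show "(\<odot>\<^bsub>?T\<^esub>) \<one>\<^bsub>R\<^esub> \<in> hom (add_monoid ?T) (add_monoid ?T)" using sm(1) by simp
      show "(\<lambda>x. x) \<in> hom (add_monoid ?T) (add_monoid ?T)" by (simp add: hom_def)
    qed (simp add: sm(2))
  qed
qed

lemma tensor_lift_exists:
  assumes M: "module R M" and N: "module R N" and P: "module R P" and B: "bilinear_map R M N P B"
  shows "\<exists>h. linear_map R (tensor R M N) P h \<and>
    (\<forall>m\<in>carrier M. \<forall>n\<in>carrier N. h (pure_tensor R M N m n) = B m n)"
proof -
  interpret M: module R M by fact
  interpret N: module R N by fact
  interpret P: module R P by fact
  interpret T: module R "tensor R M N" by (rule tensor_module[OF M N])
  let ?T = "tensor R M N"
  have cl: "B m n \<in> carrier P" if "m \<in> carrier M" "n \<in> carrier N" for m n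
    using B that by (auto simp: bilinear_map_def linear_map_def hom_def)
  obtain h where h: "h \<in> hom (add_monoid ?T) (add_monoid P)"
    "\<And>m n. m \<in> carrier M \<Longrightarrow> n \<in> carrier N \<Longrightarrow> h (pure_tensor R M N m n) = B m n"
    by (rule tensor_universal[OF M N P.a_comm_group, of B])
      (use B in \<open>auto simp: bilinear_map_def linear_map_def hom_def\<close>)
  have hc: "h x \<in> carrier P" if "x \<in> carrier ?T" for x using h(1) that by (auto simp: hom_def)
  have "h (r \<odot>\<^bsub>?T\<^esub> x) = r \<odot>\<^bsub>P\<^esub> h x" if r: "r \<in> carrier R" and x: "x \<in> carrier ?T" for r x
  proof (rule add_hom_ext[OF M N P.abelian_group_axioms _ _ _ x])
    show "(\<lambda>x. h (r \<odot>\<^bsub>?T\<^esub> x)) \<in> hom (add_monoid ?T) (add_monoid P)"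
      using h(1) r by (auto simp: hom_def T.smult_r_distr)
    show "(\<lambda>x. r \<odot>\<^bsub>P\<^esub> h x) \<in> hom (add_monoid ?T) (add_monoid P)"
      using h(1) hc r by (auto simp: hom_def P.smult_r_distr)
    show "h (r \<odot>\<^bsub>?T\<^esub> pure_tensor R M N m n) = r \<odot>\<^bsub>P\<^esub> h (pure_tensor R M N m n)" if "m \<in> carrier M" "n \<in> carrier N" for m n
      using that B r by (simp add: tensor_smult_hom[OF M N] h(2) bilinear_map_def linear_map_def)
  qed
  then show ?thesis using h by (auto simp: linear_map_def)
qed

lemma tensor_lift:
  assumes M: "module R M" and N: "module R N" and P: "module R P" and B: "bilinear_map R M N P B"
  shows "linear_map R (tensor R M N) P (tensor_lift R M N P B)"
    and "\<And>m n. m \<in> carrier M \<Longrightarrow> n \<in> carrier N \<Longrightarrow>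
      tensor_lift R M N P B (pure_tensor R M N m n) = B m n"
  using someI_ex[OF tensor_lift_exists[OF assms]] by (auto simp: tensor_lift_def)

lemma tensor_ext:
  assumes M: "module R M" and N: "module R N" and P: "module R P"
    and "linear_map R (tensor R M N) P h" "linear_map R (tensor R M N) P h'"
    and "\<And>m n. m \<in> carrier M \<Longrightarrow> n \<in> carrier N \<Longrightarrow> h (pure_tensor R M N m n) = h' (pure_tensor R M N m n)"
    and "t \<in> carrier (tensor R M N)"
  shows "h t = h' t"
  using add_hom_ext[OF M N module.axioms(2)[OF P]] assms by (auto simp: linear_map_def)

definition tensor_map ::
  "('k, 'r) ring_scheme \<Rightarrow> ('k, 'm, 'x) module_scheme \<Rightarrow> ('k, 'n, 'y) module_scheme
    \<Rightarrow> ('k, 'm2, 'x2) module_scheme \<Rightarrow> ('k, 'n2, 'y2) module_scheme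
    \<Rightarrow> ('m \<Rightarrow> 'm2) \<Rightarrow> ('n \<Rightarrow> 'n2) \<Rightarrow> ('m, 'n) tensor \<Rightarrow> ('m2, 'n2) tensor" where
  "tensor_map R M N M' N' f g =
     tensor_lift R M N (tensor R M' N') (\<lambda>m n. pure_tensor R M' N' (f m) (g n))"

definition tensor_assoc ::
  "('k, 'r) ring_scheme \<Rightarrow> ('k, 'm, 'x) module_scheme \<Rightarrow> ('k, 'n, 'y) module_scheme
    \<Rightarrow> ('k, 'p, 'z) module_scheme
    \<Rightarrow> (('m, 'n) tensor, 'p) tensor \<Rightarrow> ('m, ('n, 'p) tensor) tensor" where
  "tensor_assoc R M N P =
     tensor_lift R (tensor R M N) P (tensor R M (tensor R N P))
       (\<lambda>t p. tensor_lift R M N (tensor R M (tensor R N P))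
          (\<lambda>m n. pure_tensor R M (tensor R N P) m (pure_tensor R N P n p)) t)"


section \<open>Hopf algebras and comodules\<close>

text \<open>The library locale \<open>algebra\<close> requires commutativity, hence this version.\<close>

definition assoc_algebra :: "('k, 'r) ring_scheme \<Rightarrow> ('k, 'a, 'x) module_scheme \<Rightarrow> bool" where
  "assoc_algebra R A \<longleftrightarrow> module R A \<and> ring A \<and> bilinear_map R A A A (\<otimes>\<^bsub>A\<^esub>)"

record ('k, 'd) hopf = "('k, 'd) module" +
  comult :: "'d \<Rightarrow> ('d, 'd) tensor"
  counit :: "'d \<Rightarrow> 'k"
  antipode :: "'d \<Rightarrow> 'd"

definition coalgebra :: "('k, 'r) ring_scheme \<Rightarrow> ('k, 'd, 'x) hopf_scheme \<Rightarrow> bool" where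
  "coalgebra R C \<longleftrightarrow> module R C \<and>
     linear_map R C (tensor R C C) (comult C) \<and>
     linear_map R C (base_module R) (counit C) \<and>
     (\<forall>c\<in>carrier C.
        tensor_assoc R C C C (tensor_map R C C (tensor R C C) C (comult C) id (comult C c))
          = tensor_map R C C C (tensor R C C) id (comult C) (comult C c) \<and>
        tensor_lift R C C C (\<lambda>c1 c2. counit C c1 \<odot>\<^bsub>C\<^esub> c2) (comult C c) = c \<and>
        tensor_lift R C C C (\<lambda>c1 c2. counit C c2 \<odot>\<^bsub>C\<^esub> c1) (comult C c) = c)"

definition hopf_algebra :: "('k, 'r) ring_scheme \<Rightarrow> ('k, 'd, 'x) hopf_scheme \<Rightarrow> bool" where
  "hopf_algebra R D \<longleftrightarrow> assoc_algebra R D \<and> coalgebra R D \<and>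
     comult D \<one>\<^bsub>D\<^esub> = pure_tensor R D D \<one>\<^bsub>D\<^esub> \<one>\<^bsub>D\<^esub> \<and>
     counit D \<one>\<^bsub>D\<^esub> = \<one>\<^bsub>R\<^esub> \<and>
     (\<forall>a\<in>carrier D. \<forall>b\<in>carrier D.
        comult D (a \<otimes>\<^bsub>D\<^esub> b) =
          tensor_lift R D D (tensor R D D) (\<lambda>a1 a2.
            tensor_lift R D D (tensor R D D) (\<lambda>b1 b2.
              pure_tensor R D D (a1 \<otimes>\<^bsub>D\<^esub> b1) (a2 \<otimes>\<^bsub>D\<^esub> b2)) (comult D b)) (comult D a) \<and>
        counit D (a \<otimes>\<^bsub>D\<^esub> b) = counit D a \<otimes>\<^bsub>R\<^esub> counit D b) \<and>
     linear_map R D D (antipode D) \<and>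
     (\<forall>a\<in>carrier D.
        tensor_lift R D D D (\<lambda>a1 a2. antipode D a1 \<otimes>\<^bsub>D\<^esub> a2) (comult D a)
          = counit D a \<odot>\<^bsub>D\<^esub> \<one>\<^bsub>D\<^esub> \<and>
        tensor_lift R D D D (\<lambda>a1 a2. a1 \<otimes>\<^bsub>D\<^esub> antipode D a2) (comult D a)
          = counit D a \<odot>\<^bsub>D\<^esub> \<one>\<^bsub>D\<^esub>)"

definition hopf_map ::
  "('k, 'r) ring_scheme \<Rightarrow> ('k, 'd, 'x) hopf_scheme \<Rightarrow> ('k, 'h, 'y) hopf_scheme
    \<Rightarrow> ('d \<Rightarrow> 'h) \<Rightarrow> bool" where
  "hopf_map R D H f \<longleftrightarrow> linear_map R D H f \<and> f \<in> ring_hom D H \<and>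
     (\<forall>d\<in>carrier D.
        tensor_map R D D H H f f (comult D d) = comult H (f d) \<and>
        counit H (f d) = counit D d \<and>
        antipode H (f d) = f (antipode D d))"

text \<open>Right comodules: the coaction is \<open>\<delta>: V \<rightarrow> V \<otimes> C\<close>.\<close>

definition comodule ::
  "('k, 'r) ring_scheme \<Rightarrow> ('k, 'd, 'x) hopf_scheme \<Rightarrow> ('k, 'v, 'y) module_scheme
    \<Rightarrow> ('v \<Rightarrow> ('v, 'd) tensor) \<Rightarrow> bool" where
  "comodule R C V \<delta> \<longleftrightarrow> module R V \<and> linear_map R V (tensor R V C) \<delta> \<and>
     (\<forall>v\<in>carrier V.
        tensor_assoc R V C C (tensor_map R V C (tensor R V C) C \<delta> id (\<delta> v))
          = tensor_map R V C V (tensor R C C) id (comult C) (\<delta> v) \<and>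
        tensor_lift R V C V (\<lambda>v0 v1. counit C v1 \<odot>\<^bsub>V\<^esub> v0) (\<delta> v) = v)"

definition comodule_hom ::
  "('k, 'r) ring_scheme \<Rightarrow> ('k, 'd, 'x) hopf_scheme
    \<Rightarrow> ('k, 'v, 'y) module_scheme \<Rightarrow> ('v \<Rightarrow> ('v, 'd) tensor)
    \<Rightarrow> ('k, 'w, 'z) module_scheme \<Rightarrow> ('w \<Rightarrow> ('w, 'd) tensor)
    \<Rightarrow> ('v \<Rightarrow> 'w) \<Rightarrow> bool" where
  "comodule_hom R C V \<delta> W \<delta>' \<phi> \<longleftrightarrow> linear_map R V W \<phi> \<and>
     (\<forall>v\<in>carrier V. tensor_map R V C W C \<phi> id (\<delta> v) = \<delta>' (\<phi> v))"

definition unit_coaction ::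
  "('k, 'r) ring_scheme \<Rightarrow> ('k, 'd, 'x) hopf_scheme \<Rightarrow> 'k \<Rightarrow> ('k, 'd) tensor" where
  "unit_coaction R H r = pure_tensor R (base_module R) H r \<one>\<^bsub>H\<^esub>"

text \<open>\<open>v \<otimes> w \<mapsto> (v\<^sub>0 \<otimes> w\<^sub>0) \<otimes> v\<^sub>1 w\<^sub>1\<close>\<close>

definition tensor_coaction ::
  "('k, 'r) ring_scheme \<Rightarrow> ('k, 'd, 'x) hopf_scheme
    \<Rightarrow> ('k, 'v, 'y) module_scheme \<Rightarrow> ('v \<Rightarrow> ('v, 'd) tensor)
    \<Rightarrow> ('k, 'w, 'z) module_scheme \<Rightarrow> ('w \<Rightarrow> ('w, 'd) tensor)
    \<Rightarrow> ('v, 'w) tensor \<Rightarrow> (('v, 'w) tensor, 'd) tensor" where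
  "tensor_coaction R H V \<delta> W \<delta>' =
     (let VW = tensor R V W; P = tensor R VW H in
      tensor_lift R V W P (\<lambda>v w.
        tensor_lift R V H P (\<lambda>v0 v1.
          tensor_lift R W H P (\<lambda>w0 w1.
            pure_tensor R VW H (pure_tensor R V W v0 w0) (v1 \<otimes>\<^bsub>H\<^esub> w1)) (\<delta>' w)) (\<delta> v)))"

definition corestrict ::
  "('k, 'r) ring_scheme \<Rightarrow> ('k, 'd, 'x) hopf_scheme \<Rightarrow> ('k, 'h, 'y) hopf_scheme
    \<Rightarrow> ('d \<Rightarrow> 'h) \<Rightarrow> ('k, 'v, 'z) module_scheme \<Rightarrow> ('v \<Rightarrow> ('v, 'd) tensor)
    \<Rightarrow> 'v \<Rightarrow> ('v, 'h) tensor" where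
  "corestrict R D H f V \<delta> v = tensor_map R V D V H id f (\<delta> v)"

text \<open>
  Algebra operations on an object of \<open>CoMod\<^sub>H\<close> that are morphisms of \<open>CoMod\<^sub>H\<close>; associativity
  and unitality are imposed separately.
\<close>

definition colinear_operations ::
  "('k, 'r) ring_scheme \<Rightarrow> ('k, 'h, 'x) hopf_scheme \<Rightarrow> ('k, 'a, 'y) module_scheme
    \<Rightarrow> ('a \<Rightarrow> ('a, 'h) tensor) \<Rightarrow> bool" where
  "colinear_operations R H A \<alpha> \<longleftrightarrow>
     bilinear_map R A A A (\<otimes>\<^bsub>A\<^esub>) \<and> \<one>\<^bsub>A\<^esub> \<in> carrier A \<and>
     comodule_hom R H (tensor R A A) (tensor_coaction R H A \<alpha> A \<alpha>) A \<alpha>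
       (tensor_lift R A A A (\<otimes>\<^bsub>A\<^esub>)) \<and>
     comodule_hom R H (base_module R) (unit_coaction R H) A \<alpha> (\<lambda>r. r \<odot>\<^bsub>A\<^esub> \<one>\<^bsub>A\<^esub>)"

definition comodule_algebra ::
  "('k, 'r) ring_scheme \<Rightarrow> ('k, 'h, 'x) hopf_scheme \<Rightarrow> ('k, 'a, 'y) module_scheme
    \<Rightarrow> ('a \<Rightarrow> ('a, 'h) tensor) \<Rightarrow> bool" where
  "comodule_algebra R H A \<alpha> \<longleftrightarrow>
     comodule R H A \<alpha> \<and> assoc_algebra R A \<and> colinear_operations R H A \<alpha>"

definition comodule_algebra_map ::
  "('k, 'r) ring_scheme \<Rightarrow> ('k, 'h, 'x) hopf_scheme
    \<Rightarrow> ('k, 'a, 'y) module_scheme \<Rightarrow> ('a \<Rightarrow> ('a, 'h) tensor)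
    \<Rightarrow> ('k, 'b, 'z) module_scheme \<Rightarrow> ('b \<Rightarrow> ('b, 'h) tensor)
    \<Rightarrow> ('a \<Rightarrow> 'b) \<Rightarrow> bool" where
  "comodule_algebra_map R H A \<alpha> B \<beta> \<mu> \<longleftrightarrow>
     comodule_hom R H A \<alpha> B \<beta> \<mu> \<and> \<mu> \<in> ring_hom A B"


section \<open>Skew-pairings and coquasitriangular structures\<close>

definition skew_pairing ::
  "('k, 'r) ring_scheme \<Rightarrow> ('k, 'p, 'x) hopf_scheme \<Rightarrow> ('k, 'q, 'y) hopf_scheme
    \<Rightarrow> ('p \<Rightarrow> 'q \<Rightarrow> 'k) \<Rightarrow> bool" where
  "skew_pairing R P Q \<gamma> \<longleftrightarrow> bilinear_map R P Q (base_module R) \<gamma> \<and>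
     (\<forall>p\<in>carrier P. \<forall>p'\<in>carrier P. \<forall>q\<in>carrier Q.
        \<gamma> (p \<otimes>\<^bsub>P\<^esub> p') q =
          tensor_lift R Q Q (base_module R) (\<lambda>q1 q2. \<gamma> p q1 \<otimes>\<^bsub>R\<^esub> \<gamma> p' q2) (comult Q q)) \<and>
     (\<forall>p\<in>carrier P. \<forall>q\<in>carrier Q. \<forall>q'\<in>carrier Q.
        \<gamma> p (q \<otimes>\<^bsub>Q\<^esub> q') =
          tensor_lift R P P (base_module R) (\<lambda>p1 p2. \<gamma> p1 q' \<otimes>\<^bsub>R\<^esub> \<gamma> p2 q) (comult P p)) \<and>
     (\<forall>p\<in>carrier P. \<gamma> p \<one>\<^bsub>Q\<^esub> = counit P p) \<and>
     (\<forall>q\<in>carrier Q. \<gamma> \<one>\<^bsub>P\<^esub> q = counit Q q)"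

definition convolution ::
  "('k, 'r) ring_scheme \<Rightarrow> ('k, 'p, 'x) hopf_scheme \<Rightarrow> ('k, 'q, 'y) hopf_scheme
    \<Rightarrow> ('p \<Rightarrow> 'q \<Rightarrow> 'k) \<Rightarrow> ('p \<Rightarrow> 'q \<Rightarrow> 'k) \<Rightarrow> 'p \<Rightarrow> 'q \<Rightarrow> 'k" where
  "convolution R P Q \<gamma> \<gamma>' p q =
     tensor_lift R P P (base_module R) (\<lambda>p1 p2.
       tensor_lift R Q Q (base_module R) (\<lambda>q1 q2. \<gamma> p1 q1 \<otimes>\<^bsub>R\<^esub> \<gamma>' p2 q2) (comult Q q))
       (comult P p)"

text \<open>
  A skew-pairing of Hopf algebras has a convolution inverse, namely \<open>\<gamma> (S p) q\<close>, and it is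
  unique on the carriers.
\<close>

definition conv_inverse ::
  "('k, 'r) ring_scheme \<Rightarrow> ('k, 'p, 'x) hopf_scheme \<Rightarrow> ('k, 'q, 'y) hopf_scheme
    \<Rightarrow> ('p \<Rightarrow> 'q \<Rightarrow> 'k) \<Rightarrow> 'p \<Rightarrow> 'q \<Rightarrow> 'k" where
  "conv_inverse R P Q \<gamma> =
     (SOME \<gamma>'. bilinear_map R P Q (base_module R) \<gamma>' \<and>
        (\<forall>p\<in>carrier P. \<forall>q\<in>carrier Q.
           convolution R P Q \<gamma> \<gamma>' p q = counit P p \<otimes>\<^bsub>R\<^esub> counit Q q \<and>
           convolution R P Q \<gamma>' \<gamma> p q = counit P p \<otimes>\<^bsub>R\<^esub> counit Q q))"

definition inverse_skew_pairing ::
  "('k, 'r) ring_scheme \<Rightarrow> ('k, 'p, 'x) hopf_scheme \<Rightarrow> ('k, 'q, 'y) hopf_scheme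
    \<Rightarrow> ('p \<Rightarrow> 'q \<Rightarrow> 'k) \<Rightarrow> 'q \<Rightarrow> 'p \<Rightarrow> 'k" where
  "inverse_skew_pairing R P Q \<gamma> q p = conv_inverse R P Q \<gamma> p q"

definition coquasitriangular ::
  "('k, 'r) ring_scheme \<Rightarrow> ('k, 'd, 'x) hopf_scheme \<Rightarrow> ('d \<Rightarrow> 'd \<Rightarrow> 'k) \<Rightarrow> bool" where
  "coquasitriangular R D r \<longleftrightarrow> skew_pairing R D D r \<and>
     (\<forall>a\<in>carrier D. \<forall>b\<in>carrier D.
        tensor_lift R D D D (\<lambda>a1 a2.
          tensor_lift R D D D (\<lambda>b1 b2. r a1 b1 \<odot>\<^bsub>D\<^esub> (a2 \<otimes>\<^bsub>D\<^esub> b2)) (comult D b)) (comult D a) =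
        tensor_lift R D D D (\<lambda>a1 a2.
          tensor_lift R D D D (\<lambda>b1 b2. r a2 b2 \<odot>\<^bsub>D\<^esub> (b1 \<otimes>\<^bsub>D\<^esub> a1)) (comult D b)) (comult D a))"

definition rel_coquasitriangular ::
  "('k, 'r) ring_scheme \<Rightarrow> ('k, 'd, 'x) hopf_scheme \<Rightarrow> ('d \<Rightarrow> 'd \<Rightarrow> 'k)
    \<Rightarrow> ('k, 'h, 'y) hopf_scheme \<Rightarrow> ('d \<Rightarrow> 'h) \<Rightarrow> ('d \<Rightarrow> 'h \<Rightarrow> 'k) \<Rightarrow> bool" where
  "rel_coquasitriangular R D rD H f rH \<longleftrightarrow> skew_pairing R D H rH \<and>
     (\<forall>d1\<in>carrier D. \<forall>d2\<in>carrier D. rH d1 (f d2) = rD d1 d2) \<and>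
     (\<forall>d\<in>carrier D. \<forall>h\<in>carrier H.
        tensor_lift R D D H (\<lambda>d1 d2.
          tensor_lift R H H H (\<lambda>h1 h2. rH d1 h1 \<odot>\<^bsub>H\<^esub> (f d2 \<otimes>\<^bsub>H\<^esub> h2)) (comult H h)) (comult D d) =
        tensor_lift R D D H (\<lambda>d1 d2.
          tensor_lift R H H H (\<lambda>h1 h2. rH d2 h2 \<odot>\<^bsub>H\<^esub> (h1 \<otimes>\<^bsub>H\<^esub> f d1)) (comult H h)) (comult D d))"

definition hopf_triple ::
  "('k, 'r) ring_scheme
    \<Rightarrow> ('k, 'd, 'x) hopf_scheme \<Rightarrow> ('d \<Rightarrow> 'd \<Rightarrow> 'k)
    \<Rightarrow> ('k, 'h, 'y) hopf_scheme \<Rightarrow> ('d \<Rightarrow> 'h) \<Rightarrow> ('d \<Rightarrow> 'h \<Rightarrow> 'k)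
    \<Rightarrow> ('k, 'e, 'z) hopf_scheme \<Rightarrow> ('d \<Rightarrow> 'e) \<Rightarrow> ('d \<Rightarrow> 'e \<Rightarrow> 'k)
    \<Rightarrow> ('e \<Rightarrow> 'h \<Rightarrow> 'k) \<Rightarrow> bool" where
  "hopf_triple R D rD H f rH Hv g rHv ev \<longleftrightarrow>
     hopf_algebra R D \<and> hopf_algebra R H \<and> hopf_algebra R Hv \<and>
     hopf_map R D H f \<and> hopf_map R D Hv g \<and>
     coquasitriangular R D rD \<and>
     rel_coquasitriangular R D rD H f rH \<and>
     rel_coquasitriangular R D (inverse_skew_pairing R D D rD) Hv g rHv \<and>
     skew_pairing R Hv H ev \<and>
     (\<forall>d\<in>carrier D. \<forall>h\<in>carrier H. rH d h = ev (g d) h) \<and>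
     (\<forall>d\<in>carrier D. \<forall>h\<in>carrier Hv. conv_inverse R D Hv rHv d h = ev h (f d))"


section \<open>The algebra \<open>T\<^sup>R(1)\<close> and quantum moment maps\<close>

text \<open>
  Let \<open>T: CoMod\<^sub>D \<rightarrow> CoMod\<^sub>H\<close> be corestriction along \<open>f\<close>.  The following says that the
  \<open>D\<close>-comodule \<open>(W, \<delta>W)\<close> together with the counit \<open>\<epsilon>: T W \<rightarrow> V\<close> is the value of the right
  adjoint of \<open>T\<close> at the \<open>H\<close>-comodule \<open>(V, \<delta>V)\<close>, that is, \<open>\<epsilon>\<close> is a universal arrow from \<open>T\<close>
  to \<open>V\<close>.  \<open>CoMod\<^sub>D\<close> is taken relative to the universe given by the type \<open>'u\<close>: its objects are
  comodules on arbitrary subsets of \<open>'u\<close>, one of which is \<open>W\<close>.  Module homomorphisms are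
  compared on the carrier only.
\<close>

definition right_adjoint_at ::
  "('k, 'r) ring_scheme \<Rightarrow> ('k, 'd, 'x) hopf_scheme \<Rightarrow> ('k, 'h, 'y) hopf_scheme
    \<Rightarrow> ('d \<Rightarrow> 'h) \<Rightarrow> ('k, 'v, 'z) module_scheme \<Rightarrow> ('v \<Rightarrow> ('v, 'h) tensor)
    \<Rightarrow> ('k, 'u) module \<Rightarrow> ('u \<Rightarrow> ('u, 'd) tensor) \<Rightarrow> ('u \<Rightarrow> 'v) \<Rightarrow> bool" where
  "right_adjoint_at R D H f V \<delta>V W \<delta>W \<epsilon> \<longleftrightarrow>
     comodule R D W \<delta>W \<and>
     comodule_hom R H W (corestrict R D H f W \<delta>W) V \<delta>V \<epsilon> \<and>
     (\<forall>(X :: ('k, 'u) module) \<delta>X \<phi>.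
        comodule R D X \<delta>X \<and> comodule_hom R H X (corestrict R D H f X \<delta>X) V \<delta>V \<phi> \<longrightarrow>
        (\<exists>\<psi>. comodule_hom R D X \<delta>X W \<delta>W \<psi> \<and> (\<forall>x\<in>carrier X. \<epsilon> (\<psi> x) = \<phi> x) \<and>
           (\<forall>\<psi>'. comodule_hom R D X \<delta>X W \<delta>W \<psi>' \<and> (\<forall>x\<in>carrier X. \<epsilon> (\<psi>' x) = \<phi> x)
              \<longrightarrow> (\<forall>x\<in>carrier X. \<psi>' x = \<psi> x))))"

text \<open>
  \<open>F\<close> is \<open>T\<^sup>R(1)\<close> with the algebra structure given by the lax monoidal structure of \<open>T\<^sup>R\<close>: the
  multiplication and the unit are the \<open>D\<close>-comodule maps \<open>F \<otimes> F \<rightarrow> F\<close> and \<open>1 \<rightarrow> F\<close> adjoint to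
  \<open>\<epsilon> \<otimes> \<epsilon>: T F \<otimes> T F \<rightarrow> 1\<close> and to the identity of \<open>1\<close>.  Associativity and unitality are
  not assumed: they follow from the uniqueness of adjoints when the universe is large enough to
  contain copies of the tensor powers of \<open>F\<close>.
\<close>

definition right_adjoint_unit_algebra ::
  "('k, 'r) ring_scheme \<Rightarrow> ('k, 'd, 'x) hopf_scheme \<Rightarrow> ('k, 'h, 'y) hopf_scheme
    \<Rightarrow> ('d \<Rightarrow> 'h) \<Rightarrow> ('k, 'u) module \<Rightarrow> ('u \<Rightarrow> ('u, 'd) tensor) \<Rightarrow> ('u \<Rightarrow> 'k) \<Rightarrow> bool" where
  "right_adjoint_unit_algebra R D H f F \<delta> \<epsilon> \<longleftrightarrow>
     right_adjoint_at R D H f (base_module R) (unit_coaction R H) F \<delta> \<epsilon> \<and>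
     colinear_operations R D F \<delta> \<and>
     (\<forall>x\<in>carrier F. \<forall>y\<in>carrier F. \<epsilon> (x \<otimes>\<^bsub>F\<^esub> y) = \<epsilon> x \<otimes>\<^bsub>R\<^esub> \<epsilon> y) \<and>
     \<epsilon> \<one>\<^bsub>F\<^esub> = \<one>\<^bsub>R\<^esub>"

text \<open>The central structure \<open>\<tau>: T X \<otimes> V \<rightarrow> V \<otimes> T X\<close>, \<open>x \<otimes> v \<mapsto> r\<^sub>H(x\<^sub>1, v\<^sub>1) v\<^sub>0 \<otimes> x\<^sub>0\<close>.\<close>

definition central_iso ::
  "('k, 'r) ring_scheme \<Rightarrow> ('k, 'd, 'x) hopf_scheme \<Rightarrow> ('k, 'h, 'y) hopf_scheme
    \<Rightarrow> ('d \<Rightarrow> 'h \<Rightarrow> 'k)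
    \<Rightarrow> ('k, 'u, 'z) module_scheme \<Rightarrow> ('u \<Rightarrow> ('u, 'd) tensor)
    \<Rightarrow> ('k, 'v, 'w) module_scheme \<Rightarrow> ('v \<Rightarrow> ('v, 'h) tensor)
    \<Rightarrow> ('u, 'v) tensor \<Rightarrow> ('v, 'u) tensor" where
  "central_iso R D H rH X \<delta>X V \<delta>V =
     tensor_lift R X V (tensor R V X) (\<lambda>x v.
       tensor_lift R X D (tensor R V X) (\<lambda>x0 x1.
         tensor_lift R V H (tensor R V X) (\<lambda>v0 v1.
           rH x1 v1 \<odot>\<^bsub>tensor R V X\<^esub> pure_tensor R V X v0 x0) (\<delta>V v)) (\<delta>X x))"

definition quantum_moment_map ::
  "('k, 'r) ring_scheme \<Rightarrow> ('k, 'd, 'x) hopf_scheme \<Rightarrow> ('k, 'h, 'y) hopf_scheme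
    \<Rightarrow> ('d \<Rightarrow> 'h \<Rightarrow> 'k)
    \<Rightarrow> ('k, 'u, 'z) module_scheme \<Rightarrow> ('u \<Rightarrow> ('u, 'd) tensor)
    \<Rightarrow> ('k, 'a, 'w) module_scheme \<Rightarrow> ('a \<Rightarrow> ('a, 'h) tensor) \<Rightarrow> ('u \<Rightarrow> 'a) \<Rightarrow> bool" where
  "quantum_moment_map R D H rH F \<delta> A \<alpha> \<mu> \<longleftrightarrow>
     (\<forall>t\<in>carrier (tensor R F A).
        tensor_lift R A A A (\<otimes>\<^bsub>A\<^esub>) (tensor_map R F A A A \<mu> id t) =
        tensor_lift R A A A (\<otimes>\<^bsub>A\<^esub>)
          (tensor_map R A F A A id \<mu> (central_iso R D H rH F \<delta> A \<alpha> t)))"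

text \<open>The action \<open>h \<triangleright> v = v\<^sub>0 ev(h, v\<^sub>1)\<close> of \<open>H\<^sup>\<or>\<close> on an \<open>H\<close>-comodule.\<close>

definition dual_action ::
  "('k, 'r) ring_scheme \<Rightarrow> ('k, 'h, 'y) hopf_scheme \<Rightarrow> ('e \<Rightarrow> 'h \<Rightarrow> 'k)
    \<Rightarrow> ('k, 'v, 'w) module_scheme \<Rightarrow> ('v \<Rightarrow> ('v, 'h) tensor) \<Rightarrow> 'e \<Rightarrow> 'v \<Rightarrow> 'v" where
  "dual_action R H ev V \<delta>V h v =
     tensor_lift R V H V (\<lambda>v0 v1. ev h v1 \<odot>\<^bsub>V\<^esub> v0) (\<delta>V v)"

end

theory Submission
  imports Defs
begin

text \<open>
  Both sides of the moment map equation are linear on \<open>F \<otimes> A\<close>, so it suffices to compare them on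
  pure tensors \<open>x \<otimes> a\<close>.  There the right-hand side is
  \<open>r\<^sub>H(x\<^sub>1, a\<^sub>1) a\<^sub>0 \<mu>(x\<^sub>0) = (a\<^sub>0 ev(g(x\<^sub>1), a\<^sub>1)) \<mu>(x\<^sub>0) = (g(x\<^sub>1) \<triangleright> a) \<mu>(x\<^sub>0)\<close>.
\<close>

section \<open>Linear and bilinear maps\<close>

lemma linear_mapI:
  assumes "\<And>x. x \<in> carrier M \<Longrightarrow> h x \<in> carrier N"
    and "\<And>x y. x \<in> carrier M \<Longrightarrow> y \<in> carrier M \<Longrightarrow> h (x \<oplus>\<^bsub>M\<^esub> y) = h x \<oplus>\<^bsub>N\<^esub> h y"
    and "\<And>r x. r \<in> carrier R \<Longrightarrow> x \<in> carrier M \<Longrightarrow> h (r \<odot>\<^bsub>M\<^esub> x) = r \<odot>\<^bsub>N\<^esub> h x"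
  shows "linear_map R M N h"
  using assms by (auto simp: linear_map_def hom_def)

lemma linear_mapD:
  assumes "linear_map R M N h"
  shows "x \<in> carrier M \<Longrightarrow> h x \<in> carrier N"
    and "x \<in> carrier M \<Longrightarrow> y \<in> carrier M \<Longrightarrow> h (x \<oplus>\<^bsub>M\<^esub> y) = h x \<oplus>\<^bsub>N\<^esub> h y"
    and "r \<in> carrier R \<Longrightarrow> x \<in> carrier M \<Longrightarrow> h (r \<odot>\<^bsub>M\<^esub> x) = r \<odot>\<^bsub>N\<^esub> h x"
  using assms by (auto simp: linear_map_def hom_def)

lemma bilinear_mapI:
  assumes "\<And>n. n \<in> carrier N \<Longrightarrow> linear_map R M P (\<lambda>m. B m n)"
    and "\<And>m. m \<in> carrier M \<Longrightarrow> linear_map R N P (\<lambda>n. B m n)"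
  shows "bilinear_map R M N P B"
  using assms by (simp add: bilinear_map_def)

lemma bilinear_mapD:
  assumes "bilinear_map R M N P B"
  shows "n \<in> carrier N \<Longrightarrow> linear_map R M P (\<lambda>m. B m n)"
    and "m \<in> carrier M \<Longrightarrow> linear_map R N P (\<lambda>n. B m n)"
  using assms by (simp_all add: bilinear_map_def)

lemma linear_map_id: "linear_map R M M id"
  by (rule linear_mapI) simp_all

lemma linear_map_comp:
  assumes "linear_map R M N h" "linear_map R N P k"
  shows "linear_map R M P (\<lambda>x. k (h x))"
  by (rule linear_mapI) (simp_all add: linear_mapD[OF assms(1)] linear_mapD[OF assms(2)])

lemma linear_map_smult:
  assumes "module R P" "p \<in> carrier P"
  shows "linear_map R (base_module R) P (\<lambda>r. r \<odot>\<^bsub>P\<^esub> p)"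
proof -
  interpret P: module R P by fact
  show ?thesis
    by (rule linear_mapI) (use assms in \<open>simp_all add: base_module_def P.smult_l_distr P.smult_assoc1\<close>)
qed

lemma linear_map_smult_right:
  assumes "module R P" "r \<in> carrier R"
  shows "linear_map R P P (\<lambda>p. r \<odot>\<^bsub>P\<^esub> p)"
proof -
  interpret P: module R P by fact
  show ?thesis
    by (rule linear_mapI)
      (use assms in \<open>simp_all add: P.smult_r_distr P.smult_assoc1[symmetric] P.R.m_comm\<close>)
qed

lemma pure_tensor_bilinear:
  assumes M: "module R M" and N: "module R N"
  shows "bilinear_map R M N (tensor R M N) (pure_tensor R M N)"
proof (rule bilinear_mapI; rule linear_mapI)
\<comment> \<open>The scalar action on a tensor is defined through the left factor, so homogeneity
  in the right argument takes \<open>pure_smult\<close> to carry the scalar across.\<close>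
qed (use assms in \<open>simp_all add: pure_add_left pure_add_right tensor_smult_hom(2) pure_smult[symmetric]\<close>)

lemma bilinear_map_comp:
  assumes B: "bilinear_map R M' N' P B" and h: "linear_map R M M' h" and k: "linear_map R N N' k"
  shows "bilinear_map R M N P (\<lambda>m n. B (h m) (k n))"
  by (rule bilinear_mapI)
    (rule linear_map_comp[OF h bilinear_mapD(1)[OF B]] linear_map_comp[OF k bilinear_mapD(2)[OF B]],
      erule linear_mapD(1)[OF h] linear_mapD(1)[OF k])+

lemma bilinear_map_post:
  assumes B: "bilinear_map R M N P B" and h: "linear_map R P Q h"
  shows "bilinear_map R M N Q (\<lambda>m n. h (B m n))"
  by (rule bilinear_mapI) (rule linear_map_comp[OF _ h], erule bilinear_mapD[OF B])+

section \<open>Maps induced on tensor products, and the calculus of Sweedler sums\<close>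

lemma tensor_lift_cong:
  assumes "\<And>m n. m \<in> carrier M \<Longrightarrow> n \<in> carrier N \<Longrightarrow> B m n = B' m n"
  shows "tensor_lift R M N P B = tensor_lift R M N P B'"
proof -
  \<comment> \<open>The predicate under the choice operator sees the bilinear map on the carriers
    alone. Equal predicates give the same chosen function, so the two lifts agree at every argument,
    including those outside the carrier of the tensor product.\<close>
  have "(\<forall>m\<in>carrier M. \<forall>n\<in>carrier N. h (pure_tensor R M N m n) = B m n) \<longleftrightarrow>
    (\<forall>m\<in>carrier M. \<forall>n\<in>carrier N. h (pure_tensor R M N m n) = B' m n)" for h
    using assms by auto
  then show ?thesis by (simp add: tensor_lift_def)
qed

text \<open>Both sides are linear in \<open>t\<close> and take the value \<open>h (B m n)\<close> on
  pure tensors, so \<open>tensor_ext\<close> identifies them. This is how a linear map is pushed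
  inside a Sweedler sum.\<close>

lemma linear_map_tensor_lift:
  assumes M: "module R M" and N: "module R N" and P: "module R P" and Q: "module R Q"
    and B: "bilinear_map R M N P B" and h: "linear_map R P Q h"
    and t: "t \<in> carrier (tensor R M N)"
  shows "h (tensor_lift R M N P B t) = tensor_lift R M N Q (\<lambda>m n. h (B m n)) t"
proof (rule tensor_ext[OF M N Q _ _ _ t])
  note L = tensor_lift[OF M N P B] and L' = tensor_lift[OF M N Q bilinear_map_post[OF B h]]
  show "linear_map R (tensor R M N) Q (\<lambda>t. h (tensor_lift R M N P B t))"
    by (rule linear_map_comp[OF L(1) h])
  show "linear_map R (tensor R M N) Q (tensor_lift R M N Q (\<lambda>m n. h (B m n)))"
    by (rule L'(1))
  show "h (tensor_lift R M N P B (pure_tensor R M N m n)) =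
      tensor_lift R M N Q (\<lambda>m n. h (B m n)) (pure_tensor R M N m n)"
    if "m \<in> carrier M" "n \<in> carrier N" for m n
    using that by (simp add: L(2) L'(2))
qed

text \<open>Needed for nested Sweedler sums, where the integrand depends on an outer variable
  \<open>v\<close> while the tensor \<open>t\<close> is fixed. A sum or scalar multiple of lifts is
  again linear in \<open>t\<close>, and pointwise linearity of \<open>B\<close> in \<open>v\<close>
  gives it the right values on pure tensors; uniqueness of the induced map does the rest.\<close>

lemma tensor_lift_linear_param:
  assumes V: "module R V" and M: "module R M" and N: "module R N" and P: "module R P"
    and B: "\<And>v. v \<in> carrier V \<Longrightarrow> bilinear_map R M N P (B v)"
    and l: "\<And>m n. m \<in> carrier M \<Longrightarrow> n \<in> carrier N \<Longrightarrow> linear_map R V P (\<lambda>v. B v m n)"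
    and t: "t \<in> carrier (tensor R M N)"
  shows "linear_map R V P (\<lambda>v. tensor_lift R M N P (B v) t)"
proof -
  interpret V: module R V by fact
  interpret P: module R P by fact
  interpret T: module R "tensor R M N" by (rule tensor_module[OF M N])
  note L = tensor_lift[OF M N P B] and D = linear_mapD[OF tensor_lift(1)[OF M N P B]]
  show ?thesis
  proof (rule linear_mapI)
    show "tensor_lift R M N P (B v) t \<in> carrier P" if "v \<in> carrier V" for v
      using D(1) that t by simp
    show "tensor_lift R M N P (B (v \<oplus>\<^bsub>V\<^esub> w)) t =
        tensor_lift R M N P (B v) t \<oplus>\<^bsub>P\<^esub> tensor_lift R M N P (B w) t"
      if v: "v \<in> carrier V" and w: "w \<in> carrier V" for v w
    proof (rule tensor_ext[OF M N P L(1) _ _ t])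
      show "linear_map R (tensor R M N) P
          (\<lambda>t. tensor_lift R M N P (B v) t \<oplus>\<^bsub>P\<^esub> tensor_lift R M N P (B w) t)"
        by (rule linear_mapI) (simp_all add: D v w P.a_ac P.smult_r_distr)
    qed (use v w in \<open>simp_all add: L(2) linear_mapD(2)[OF l]\<close>)
    show "tensor_lift R M N P (B (r \<odot>\<^bsub>V\<^esub> v)) t = r \<odot>\<^bsub>P\<^esub> tensor_lift R M N P (B v) t"
      if r: "r \<in> carrier R" and v: "v \<in> carrier V" for r v
    proof (rule tensor_ext[OF M N P L(1) _ _ t])
      show "linear_map R (tensor R M N) P (\<lambda>t. r \<odot>\<^bsub>P\<^esub> tensor_lift R M N P (B v) t)"
        by (rule linear_map_comp[OF L(1)[OF v] linear_map_smult_right[OF P r]])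
    qed (use r v in \<open>simp_all add: L(2) linear_mapD(3)[OF l]\<close>)
  qed
qed

lemma tensor_map:
  assumes M: "module R M" and N: "module R N" and M': "module R M'" and N': "module R N'"
    and h: "linear_map R M M' h" and k: "linear_map R N N' k"
  shows "linear_map R (tensor R M N) (tensor R M' N') (tensor_map R M N M' N' h k)"
    and "\<And>m n. m \<in> carrier M \<Longrightarrow> n \<in> carrier N \<Longrightarrow>
      tensor_map R M N M' N' h k (pure_tensor R M N m n) = pure_tensor R M' N' (h m) (k n)"
  using tensor_lift[OF M N tensor_module[OF M' N']
      bilinear_map_comp[OF pure_tensor_bilinear[OF M' N'] h k]]
  unfolding tensor_map_def by simp_all

text \<open>Substitution in a Sweedler sum: \<open>tensor_map\<close> is itself a lift, so the outer
  lift moves inside it and is evaluated on pure tensors. It serves to rewrite a sum over a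
  corestricted coaction as one over the original coaction.\<close>

lemma tensor_lift_tensor_map:
  assumes M: "module R M" and N: "module R N" and M': "module R M'" and N': "module R N'"
    and P: "module R P" and B: "bilinear_map R M' N' P B"
    and h: "linear_map R M M' h" and k: "linear_map R N N' k"
    and t: "t \<in> carrier (tensor R M N)"
  shows "tensor_lift R M' N' P B (tensor_map R M N M' N' h k t) =
    tensor_lift R M N P (\<lambda>m n. B (h m) (k n)) t"
proof -
  note T = tensor_lift[OF M' N' P B]
  have "tensor_lift R M' N' P B (tensor_map R M N M' N' h k t) =
      tensor_lift R M N P (\<lambda>m n. tensor_lift R M' N' P B (pure_tensor R M' N' (h m) (k n))) t"
    unfolding tensor_map_def
    by (rule linear_map_tensor_lift[OF M N tensor_module[OF M' N'] P
          bilinear_map_comp[OF pure_tensor_bilinear[OF M' N'] h k] T(1) t])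
  also have "\<dots> = tensor_lift R M N P (\<lambda>m n. B (h m) (k n)) t"
    by (rule fun_cong[OF tensor_lift_cong])
      (simp add: T(2) linear_mapD(1)[OF h] linear_mapD(1)[OF k])
  finally show ?thesis .
qed

section \<open>Pairings, the map \<tau> and the action of \<open>Hv\<close>\<close>

lemma bilinear_form_smult:
  assumes P: "module R P" and r: "bilinear_map R D H (base_module R) r"
  shows "d \<in> carrier D \<Longrightarrow> h \<in> carrier H \<Longrightarrow> r d h \<in> carrier R"
    and "p \<in> carrier P \<Longrightarrow> h \<in> carrier H \<Longrightarrow> linear_map R D P (\<lambda>d. r d h \<odot>\<^bsub>P\<^esub> p)"
    and "p \<in> carrier P \<Longrightarrow> d \<in> carrier D \<Longrightarrow> linear_map R H P (\<lambda>h. r d h \<odot>\<^bsub>P\<^esub> p)"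
  using linear_mapD(1)[OF bilinear_mapD(1)[OF r]]
    linear_map_comp[OF bilinear_mapD(1)[OF r] linear_map_smult[OF P]]
    linear_map_comp[OF bilinear_mapD(2)[OF r] linear_map_smult[OF P]]
  by (auto simp: base_module_def)

text \<open>The Sweedler sum \<open>r(x\<^sub>1, v\<^sub>1) B(v\<^sub>0, x\<^sub>0)\<close>; with \<open>B = (\<otimes>)\<close> it is the map \<open>\<tau>\<close>.\<close>

lemma twisted_pairing_bilinear:
  assumes X: "module R X" and D: "module R D" and V: "module R V" and H: "module R H"
    and P: "module R P"
    and r: "bilinear_map R D H (base_module R) r" and B: "bilinear_map R V X P B"
  shows "x0 \<in> carrier X \<Longrightarrow> x1 \<in> carrier D \<Longrightarrow>
      bilinear_map R V H P (\<lambda>v0 v1. r x1 v1 \<odot>\<^bsub>P\<^esub> B v0 x0)"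
    and "s \<in> carrier (tensor R V H) \<Longrightarrow> bilinear_map R X D P
      (\<lambda>x0 x1. tensor_lift R V H P (\<lambda>v0 v1. r x1 v1 \<odot>\<^bsub>P\<^esub> B v0 x0) s)"
    and "linear_map R X (tensor R X D) \<delta>X \<Longrightarrow> linear_map R V (tensor R V H) \<delta>V \<Longrightarrow>
      bilinear_map R X V P (\<lambda>x v. tensor_lift R X D P (\<lambda>x0 x1.
        tensor_lift R V H P (\<lambda>v0 v1. r x1 v1 \<odot>\<^bsub>P\<^esub> B v0 x0) (\<delta>V v)) (\<delta>X x))"
proof -
  note S = bilinear_form_smult[OF P r]
  note sr = linear_map_smult_right[OF P S(1)]
  note Bc = linear_mapD(1)[OF bilinear_mapD(1)[OF B]]
  show inner: "bilinear_map R V H P (\<lambda>v0 v1. r x1 v1 \<odot>\<^bsub>P\<^esub> B v0 x0)"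
    if "x0 \<in> carrier X" "x1 \<in> carrier D" for x0 x1
    using that by (intro bilinear_mapI linear_map_comp[OF bilinear_mapD(1)[OF B] sr] S(3) Bc)
  \<comment> \<open>The tensor \<open>s\<close> is held fixed; \<open>x0\<close> and
    \<open>x1\<close> enter through the integrand, one through \<open>B\<close> and the other
    through \<open>r\<close>, so each linearity is a case of
    \<open>tensor_lift_linear_param\<close>.\<close>
  show mid: "bilinear_map R X D P
      (\<lambda>x0 x1. tensor_lift R V H P (\<lambda>v0 v1. r x1 v1 \<odot>\<^bsub>P\<^esub> B v0 x0) s)"
    if s: "s \<in> carrier (tensor R V H)" for s
  proof (rule bilinear_mapI)
    show "linear_map R X P (\<lambda>x0. tensor_lift R V H P (\<lambda>v0 v1. r x1 v1 \<odot>\<^bsub>P\<^esub> B v0 x0) s)"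
      if "x1 \<in> carrier D" for x1
      using that by (intro tensor_lift_linear_param[OF X V H P _ _ s] inner
          linear_map_comp[OF bilinear_mapD(2)[OF B] sr])
    show "linear_map R D P (\<lambda>x1. tensor_lift R V H P (\<lambda>v0 v1. r x1 v1 \<odot>\<^bsub>P\<^esub> B v0 x0) s)"
      if "x0 \<in> carrier X" for x0
      using that by (intro tensor_lift_linear_param[OF D V H P _ _ s] inner S(2) Bc)
  qed
  assume \<delta>X: "linear_map R X (tensor R X D) \<delta>X" and \<delta>V: "linear_map R V (tensor R V H) \<delta>V"
  show "bilinear_map R X V P (\<lambda>x v. tensor_lift R X D P (\<lambda>x0 x1.
        tensor_lift R V H P (\<lambda>v0 v1. r x1 v1 \<odot>\<^bsub>P\<^esub> B v0 x0) (\<delta>V v)) (\<delta>X x))"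
  proof (rule bilinear_mapI)
    \<comment> \<open>For fixed \<open>v\<close> the integrand of the outer sum is fixed, and
      \<open>x\<close> occurs only in the tensor \<open>\<delta>X x\<close>: a composition of linear
      maps.\<close>
    show "linear_map R X P (\<lambda>x. tensor_lift R X D P (\<lambda>x0 x1.
        tensor_lift R V H P (\<lambda>v0 v1. r x1 v1 \<odot>\<^bsub>P\<^esub> B v0 x0) (\<delta>V v)) (\<delta>X x))"
      if "v \<in> carrier V" for v
      by (rule linear_map_comp[OF \<delta>X tensor_lift(1)[OF X D P mid[OF linear_mapD(1)[OF \<delta>V that]]]])
    \<comment> \<open>For fixed \<open>x\<close> the roles are reversed: the outer tensor
      \<open>\<delta>X x\<close> is fixed, and \<open>v\<close> is a parameter of the integrand, on
      which it acts through \<open>\<delta>V\<close>.\<close>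
    show "linear_map R V P (\<lambda>v. tensor_lift R X D P (\<lambda>x0 x1.
        tensor_lift R V H P (\<lambda>v0 v1. r x1 v1 \<odot>\<^bsub>P\<^esub> B v0 x0) (\<delta>V v)) (\<delta>X x))"
      if "x \<in> carrier X" for x
      by (rule tensor_lift_linear_param[OF V X D P mid[OF linear_mapD(1)[OF \<delta>V]] _
            linear_mapD(1)[OF \<delta>X that]])
        (assumption, rule linear_map_comp[OF \<delta>V tensor_lift(1)[OF V H P inner]])
  qed
qed

text \<open>The Sweedler formula is bilinear in \<open>x\<close> and \<open>v\<close>, by
  \<open>twisted_pairing_bilinear\<close> with \<open>B\<close> the pure tensor. This is what makes
  the lift defining \<open>central_iso\<close> a genuine induced map rather than an arbitrary value
  of the choice operator.\<close>

lemma central_iso: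
  assumes "module R X" "module R D" "module R V" "module R H"
    and "bilinear_map R D H (base_module R) r"
    and "linear_map R X (tensor R X D) \<delta>X" "linear_map R V (tensor R V H) \<delta>V"
  shows "linear_map R (tensor R X V) (tensor R V X) (central_iso R D H r X \<delta>X V \<delta>V)"
    and "x \<in> carrier X \<Longrightarrow> v \<in> carrier V \<Longrightarrow>
      central_iso R D H r X \<delta>X V \<delta>V (pure_tensor R X V x v) =
        tensor_lift R X D (tensor R V X) (\<lambda>x0 x1.
          tensor_lift R V H (tensor R V X) (\<lambda>v0 v1.
            r x1 v1 \<odot>\<^bsub>tensor R V X\<^esub> pure_tensor R V X v0 x0) (\<delta>V v)) (\<delta>X x)"
  using tensor_lift[OF assms(1,3) tensor_module[OF assms(3,1)]
      twisted_pairing_bilinear(3)[OF assms(1-4) tensor_module[OF assms(3,1)] assms(5)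
        pure_tensor_bilinear[OF assms(3,1)] assms(6,7)]]
  unfolding central_iso_def by simp_all

text \<open>Linearity takes \<Phi> through the outer sum, then through the inner one, and finally
  past the scalar \<open>r x1 v1\<close>. In the theorem \<Phi> is the map
  \<open>m (id \<otimes> \<mu>)\<close>.\<close>

lemma central_iso_post:
  assumes X: "module R X" and D: "module R D" and V: "module R V" and H: "module R H"
    and P: "module R P"
    and r: "bilinear_map R D H (base_module R) r"
    and \<delta>X: "linear_map R X (tensor R X D) \<delta>X" and \<delta>V: "linear_map R V (tensor R V H) \<delta>V"
    and \<Phi>: "linear_map R (tensor R V X) P \<Phi>"
    and x: "x \<in> carrier X" and v: "v \<in> carrier V"
  shows "\<Phi> (central_iso R D H r X \<delta>X V \<delta>V (pure_tensor R X V x v)) =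
    tensor_lift R X D P (\<lambda>x0 x1. tensor_lift R V H P (\<lambda>v0 v1.
      r x1 v1 \<odot>\<^bsub>P\<^esub> \<Phi> (pure_tensor R V X v0 x0)) (\<delta>V v)) (\<delta>X x)"
proof -
  let ?T = "tensor R V X"
  let ?I = "\<lambda>x0 x1 v0 v1. r x1 v1 \<odot>\<^bsub>?T\<^esub> pure_tensor R V X v0 x0"
  have T: "module R ?T" by (rule tensor_module[OF V X])
  note tw = twisted_pairing_bilinear[OF X D V H T r pure_tensor_bilinear[OF V X]]
  note \<delta>v = linear_mapD(1)[OF \<delta>V v] and \<delta>x = linear_mapD(1)[OF \<delta>X x]
  have "\<Phi> (central_iso R D H r X \<delta>X V \<delta>V (pure_tensor R X V x v)) =
      \<Phi> (tensor_lift R X D ?T (\<lambda>x0 x1. tensor_lift R V H ?T (?I x0 x1) (\<delta>V v)) (\<delta>X x))"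
    by (simp add: central_iso(2)[OF X D V H r \<delta>X \<delta>V x v])
  also have "\<dots> = tensor_lift R X D P
      (\<lambda>x0 x1. \<Phi> (tensor_lift R V H ?T (?I x0 x1) (\<delta>V v))) (\<delta>X x)"
    by (rule linear_map_tensor_lift[OF X D T P tw(2)[OF \<delta>v] \<Phi> \<delta>x])
  also have "\<dots> = tensor_lift R X D P (\<lambda>x0 x1. tensor_lift R V H P (\<lambda>v0 v1.
      r x1 v1 \<odot>\<^bsub>P\<^esub> \<Phi> (pure_tensor R V X v0 x0)) (\<delta>V v)) (\<delta>X x)"
  \<comment> \<open>The integrand need only be rewritten for \<open>x0\<close> and \<open>x1\<close>
    in their carriers, where the inner integrand is known to be bilinear and \<open>r x1 v1\<close>
    to be a scalar.\<close>
  proof (rule fun_cong[OF tensor_lift_cong])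
    fix x0 x1 assume x01: "x0 \<in> carrier X" "x1 \<in> carrier D"
    have "\<Phi> (tensor_lift R V H ?T (?I x0 x1) (\<delta>V v)) =
        tensor_lift R V H P (\<lambda>v0 v1. \<Phi> (?I x0 x1 v0 v1)) (\<delta>V v)"
      by (rule linear_map_tensor_lift[OF V H T P tw(1)[OF x01] \<Phi> \<delta>v])
    also have "\<dots> = tensor_lift R V H P
        (\<lambda>v0 v1. r x1 v1 \<odot>\<^bsub>P\<^esub> \<Phi> (pure_tensor R V X v0 x0)) (\<delta>V v)"
      by (rule fun_cong[OF tensor_lift_cong])
        (simp add: linear_mapD(3)[OF \<Phi>] bilinear_form_smult(1)[OF P r] x01)
    finally show "\<Phi> (tensor_lift R V H ?T (?I x0 x1) (\<delta>V v)) = tensor_lift R V H P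
        (\<lambda>v0 v1. r x1 v1 \<odot>\<^bsub>P\<^esub> \<Phi> (pure_tensor R V X v0 x0)) (\<delta>V v)" .
  qed
  finally show ?thesis .
qed

text \<open>The first part makes the Sweedler sum defining the action a true induced map. The
  second, linearity in the acting element, allows that element to be a Sweedler component of the
  \<open>Hv\<close>-coaction.\<close>

lemma dual_action_bilinear:
  assumes E: "module R E" and H: "module R H" and V: "module R V"
    and ev: "bilinear_map R E H (base_module R) ev"
    and \<delta>V: "linear_map R V (tensor R V H) \<delta>V" and v: "v \<in> carrier V"
  shows "e \<in> carrier E \<Longrightarrow> bilinear_map R V H V (\<lambda>v0 v1. ev e v1 \<odot>\<^bsub>V\<^esub> v0)"
    and "linear_map R E V (\<lambda>e. dual_action R H ev V \<delta>V e v)"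
proof -
  note S = bilinear_form_smult[OF V ev]
  show inner: "bilinear_map R V H V (\<lambda>v0 v1. ev e v1 \<odot>\<^bsub>V\<^esub> v0)" if "e \<in> carrier E" for e
    using that by (intro bilinear_mapI linear_map_smult_right[OF V S(1)] S(3))
  show "linear_map R E V (\<lambda>e. dual_action R H ev V \<delta>V e v)"
    unfolding dual_action_def
    by (rule tensor_lift_linear_param[OF E V H V inner S(2) linear_mapD(1)[OF \<delta>V v]])
qed

section \<open>The moment map equation on pure tensors\<close>

theorem theorem3p14:
  fixes R :: "'k ring"
    and D :: "('k, 'd) hopf" and H :: "('k, 'h) hopf" and Hv :: "('k, 'e) hopf"
    and rD :: "'d \<Rightarrow> 'd \<Rightarrow> 'k" and rH :: "'d \<Rightarrow> 'h \<Rightarrow> 'k" and rHv :: "'d \<Rightarrow> 'e \<Rightarrow> 'k"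
    and f :: "'d \<Rightarrow> 'h" and g :: "'d \<Rightarrow> 'e" and ev :: "'e \<Rightarrow> 'h \<Rightarrow> 'k"
    and F :: "('k, 'u) module" and \<delta> :: "'u \<Rightarrow> ('u, 'd) tensor" and \<epsilon> :: "'u \<Rightarrow> 'k"
    and A :: "('k, 'a) module" and \<alpha> :: "'a \<Rightarrow> ('a, 'h) tensor" and \<mu> :: "'u \<Rightarrow> 'a"
  assumes "cring R"
    and "hopf_triple R D rD H f rH Hv g rHv ev"
    and "right_adjoint_unit_algebra R D H f F \<delta> \<epsilon>"
    and "comodule_algebra R H A \<alpha>"
    and "comodule_algebra_map R H F (corestrict R D H f F \<delta>) A \<alpha> \<mu>"
  shows "quantum_moment_map R D H rH F \<delta> A \<alpha> \<mu> \<longleftrightarrow>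
    (\<forall>h\<in>carrier F. \<forall>a\<in>carrier A.
       \<mu> h \<otimes>\<^bsub>A\<^esub> a =
         tensor_lift R F Hv A
           (\<lambda>h0 h1. dual_action R H ev A \<alpha> h1 a \<otimes>\<^bsub>A\<^esub> \<mu> h0)
           (corestrict R D Hv g F \<delta> h))"
proof -
  \<comment> \<open>The fact \<open>rH_ev\<close> is the bridge between \<tau>, built from
    \<open>rH\<close>, and the action, built from \<open>ev\<close>.\<close>
  have hopf: "module R D" "module R H" "module R Hv"
    and g: "linear_map R D Hv g"
    and rH: "bilinear_map R D H (base_module R) rH"
    and ev: "bilinear_map R Hv H (base_module R) ev"
    and rH_ev: "\<And>d h. d \<in> carrier D \<Longrightarrow> h \<in> carrier H \<Longrightarrow> rH d h = ev (g d) h"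
    using assms(2) unfolding hopf_triple_def hopf_algebra_def coalgebra_def hopf_map_def
      rel_coquasitriangular_def skew_pairing_def by blast+
  note D = hopf(1) and H = hopf(2) and Hv = hopf(3)
  have F: "module R F" and \<delta>: "linear_map R F (tensor R F D) \<delta>"
    using assms(3) unfolding right_adjoint_unit_algebra_def right_adjoint_at_def comodule_def by blast+
  have A: "module R A" and \<alpha>: "linear_map R A (tensor R A H) \<alpha>"
    and mult: "bilinear_map R A A A (\<otimes>\<^bsub>A\<^esub>)"
    using assms(4) unfolding comodule_algebra_def comodule_def assoc_algebra_def by blast+
  have \<mu>: "linear_map R F A \<mu>"
    using assms(5) unfolding comodule_algebra_map_def comodule_hom_def by blast+
  interpret A: module R A by fact
  note muc = linear_mapD(1)[OF \<mu>]
  let ?m = "tensor_lift R A A A (\<otimes>\<^bsub>A\<^esub>)"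
  \<comment> \<open>With \<open>?L\<close> for \<open>m (\<mu> \<otimes> id)\<close> and
    \<open>?\<Phi>\<close> for \<open>m (id \<otimes> \<mu>)\<close>, the moment map condition is
    \<open>?L t = ?\<Phi> (?\<tau> t)\<close>.\<close>
  let ?L = "\<lambda>t. ?m (tensor_map R F A A A \<mu> id t)"
  let ?\<Phi> = "\<lambda>t. ?m (tensor_map R A F A A id \<mu> t)"
  let ?\<tau> = "central_iso R D H rH F \<delta> A \<alpha>"
  note m = tensor_lift[OF A A A mult]
  note m1 = tensor_map[OF F A A A \<mu> linear_map_id]
  note m2 = tensor_map[OF A F A A linear_map_id \<mu>]
  have L: "linear_map R (tensor R F A) A ?L"
    by (rule linear_map_comp[OF m1(1) m(1)])
  have \<Phi>: "linear_map R (tensor R A F) A ?\<Phi>"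
    by (rule linear_map_comp[OF m2(1) m(1)])
  have R: "linear_map R (tensor R F A) A (\<lambda>t. ?\<Phi> (?\<tau> t))"
    by (rule linear_map_comp[OF central_iso(1)[OF F D A H rH \<delta> \<alpha>] \<Phi>])
  have Lp: "?L (pure_tensor R F A x a) = \<mu> x \<otimes>\<^bsub>A\<^esub> a" if "x \<in> carrier F" "a \<in> carrier A" for x a
    using that by (simp add: m1(2) m(2) muc)
  have Rp: "?\<Phi> (?\<tau> (pure_tensor R F A x a)) = tensor_lift R F Hv A
      (\<lambda>h0 h1. dual_action R H ev A \<alpha> h1 a \<otimes>\<^bsub>A\<^esub> \<mu> h0) (corestrict R D Hv g F \<delta> x)"
    if x: "x \<in> carrier F" and a: "a \<in> carrier A" for x a
  proof -
    note \<alpha>a = linear_mapD(1)[OF \<alpha> a] and \<delta>x = linear_mapD(1)[OF \<delta> x]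
    note act = dual_action_bilinear[OF Hv H A ev \<alpha> a]
    \<comment> \<open>Bilinearity gives the right-hand side of the criterion its meaning as a
      Sweedler sum over the \<open>Hv\<close>-coaction, and it licenses the final substitution along
      \<open>g\<close>.\<close>
    have bil: "bilinear_map R F Hv A (\<lambda>h0 h1. dual_action R H ev A \<alpha> h1 a \<otimes>\<^bsub>A\<^esub> \<mu> h0)"
      by (intro bilinear_mapI linear_map_comp[OF \<mu> bilinear_mapD(2)[OF mult]]
          linear_map_comp[OF act(2) bilinear_mapD(1)[OF mult]] linear_mapD(1)[OF act(2)] muc)
    have "?\<Phi> (?\<tau> (pure_tensor R F A x a)) = tensor_lift R F D A (\<lambda>x0 x1. tensor_lift R A H A
        (\<lambda>a0 a1. rH x1 a1 \<odot>\<^bsub>A\<^esub> ?\<Phi> (pure_tensor R A F a0 x0)) (\<alpha> a)) (\<delta> x)"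
      by (rule central_iso_post[OF F D A H A rH \<delta> \<alpha> \<Phi> x a])
    also have "\<dots> = tensor_lift R F D A
        (\<lambda>x0 x1. dual_action R H ev A \<alpha> (g x1) a \<otimes>\<^bsub>A\<^esub> \<mu> x0) (\<delta> x)"
    proof (rule fun_cong[OF tensor_lift_cong])
      fix x0 x1 assume x01: "x0 \<in> carrier F" "x1 \<in> carrier D"
      note gx1 = linear_mapD(1)[OF g x01(2)]
      note mx = bilinear_mapD(1)[OF mult muc[OF x01(1)]]
      \<comment> \<open>Here \<open>rH x1 a1\<close> becomes \<open>ev (g x1) a1\<close>. The scalar
        moves into the left factor because right multiplication by \<open>\<mu> x0\<close> is
        linear.\<close>
      have "tensor_lift R A H A
          (\<lambda>a0 a1. rH x1 a1 \<odot>\<^bsub>A\<^esub> ?\<Phi> (pure_tensor R A F a0 x0)) (\<alpha> a) =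
          tensor_lift R A H A (\<lambda>a0 a1. (ev (g x1) a1 \<odot>\<^bsub>A\<^esub> a0) \<otimes>\<^bsub>A\<^esub> \<mu> x0) (\<alpha> a)"
        by (rule fun_cong[OF tensor_lift_cong])
          (simp add: m2(2) m(2) muc x01 rH_ev linear_mapD(3)[OF mx]
            bilinear_form_smult(1)[OF A ev] gx1)
      \<comment> \<open>The same linearity takes the factor \<open>\<mu> x0\<close> out of the sum
        over \<open>\<alpha> a\<close>; what remains is the action of \<open>g x1\<close> on
        \<open>a\<close>.\<close>
      also have "\<dots> = dual_action R H ev A \<alpha> (g x1) a \<otimes>\<^bsub>A\<^esub> \<mu> x0"
        unfolding dual_action_def
        by (rule linear_map_tensor_lift[OF A H A A act(1)[OF gx1] mx \<alpha>a, symmetric])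
      finally show "tensor_lift R A H A
          (\<lambda>a0 a1. rH x1 a1 \<odot>\<^bsub>A\<^esub> ?\<Phi> (pure_tensor R A F a0 x0)) (\<alpha> a) =
          dual_action R H ev A \<alpha> (g x1) a \<otimes>\<^bsub>A\<^esub> \<mu> x0" .
    qed
    \<comment> \<open>The \<open>Hv\<close>-coaction is \<delta> followed by
      \<open>id \<otimes> g\<close>, so summing over it is summing over \<open>\<delta> x\<close>
      with \<open>g x1\<close> in place of \<open>h1\<close>.\<close>
    also have "\<dots> = tensor_lift R F Hv A
        (\<lambda>h0 h1. dual_action R H ev A \<alpha> h1 a \<otimes>\<^bsub>A\<^esub> \<mu> h0) (corestrict R D Hv g F \<delta> x)"
      unfolding corestrict_def
      by (simp add: tensor_lift_tensor_map[OF F D F Hv A bil linear_map_id g \<delta>x])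
    finally show ?thesis .
  qed
  show ?thesis
    unfolding quantum_moment_map_def
  proof (intro iffI ballI)
    fix x a assume q: "\<forall>t\<in>carrier (tensor R F A). ?L t = ?\<Phi> (?\<tau> t)"
      and xa: "x \<in> carrier F" "a \<in> carrier A"
    have "\<mu> x \<otimes>\<^bsub>A\<^esub> a = ?L (pure_tensor R F A x a)"
      by (rule Lp[OF xa, symmetric])
    also have "\<dots> = ?\<Phi> (?\<tau> (pure_tensor R F A x a))"
      by (rule bspec[OF q pure_tensor_closed[OF xa]])
    also note Rp[OF xa]
    finally show "\<mu> x \<otimes>\<^bsub>A\<^esub> a = tensor_lift R F Hv A
      (\<lambda>h0 h1. dual_action R H ev A \<alpha> h1 a \<otimes>\<^bsub>A\<^esub> \<mu> h0) (corestrict R D Hv g F \<delta> x)" .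
  next
    fix t assume q: "\<forall>h\<in>carrier F. \<forall>a\<in>carrier A. \<mu> h \<otimes>\<^bsub>A\<^esub> a = tensor_lift R F Hv A
        (\<lambda>h0 h1. dual_action R H ev A \<alpha> h1 a \<otimes>\<^bsub>A\<^esub> \<mu> h0) (corestrict R D Hv g F \<delta> h)"
      and t: "t \<in> carrier (tensor R F A)"
    show "?L t = ?\<Phi> (?\<tau> t)"
    proof (rule tensor_ext[OF F A A L R _ t])
      fix x a assume xa: "x \<in> carrier F" "a \<in> carrier A"
      show "?L (pure_tensor R F A x a) = ?\<Phi> (?\<tau> (pure_tensor R F A x a))"
        unfolding Lp[OF xa] Rp[OF xa] by (rule q[rule_format, OF xa])
    qed
  qed
qed

end
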